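(* Let $\gamma\in(1,2)$, $0\le\theta<\gamma-1$, $\kappa>0$, $\alpha,\beta\in(0,1)$, and for each $N$ let $\mu_N$ be a probability measure on $\Omega_N$. Then for any $T>0$, $$\limsup_{\epsilon\to0}\limsup_{N\to\infty}\mathbb E_{\mu_N}\left[\left|\int_0^T\big(\alpha-\overrightarrow\eta_s^{\epsilon N}(0)\big)ds\right|\right]=0,$$ $$\limsup_{\epsilon\to0}\limsup_{N\to\infty}\mathbb E_{\mu_N}\left[\left|\int_0^T\big(\beta-\overleftarrow\eta_s^{\epsilon N}(N)\big)ds\right|\right]=0.$$
   Context: Let $c_\gamma=\big(\sum_{z\in\mathbb Z\setminus\{0\}}|z|^{-\gamma-1}\big)^{-1}$, $p(z)=c_\gamma|z|^{-\gamma-1}$ for $z\in\mathbb Z\setminus\{0\}$, $p(0)=0$. For $N\ge2$ let $\Lambda_N=\{1,\dots,N-1\}$ and $\Omega_N=\{0,1\}^{\Lambda_N}$. For $\eta\in\Omega_N$, $\sigma^{x,y}\eta$ is $\eta$ with the values at $x$ and $y$ exchanged, $\sigma^x\eta$ is $\eta$ with the value at $x$ replaced by $1-\eta(x)$, and $c_x(\eta;\delta)=\eta(x)(1-\delta)+(1-\eta(x))\delta$. The generator acts on $f:\Omega_N\to\mathbb R$ by $$L_Nf(\eta)=\tfrac12\sum_{x,y\in\Lambda_N}p(x-y)[f(\sigma^{x,y}\eta)-f(\eta)]+\tfrac{\kappa}{N^\theta}\sum_{x\in\Lambda_N,\,y\le0}p(x-y)c_x(\eta;\alpha)[f(\sigma^x\eta)-f(\eta)]+\tfrac{\kappa}{N^\theta}\sum_{x\in\Lambda_N,\,y\ge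 N}p(x-y)c_x(\eta;\beta)[f(\sigma^x\eta)-f(\eta)],$$ with $y\in\mathbb Z$. $\mathbb E_{\mu_N}$ is the expectation for the Markov process $\eta^N_\cdot$ on $\Omega_N$ with generator $N^\gamma L_N$ and initial law $\mu_N$. Empirical averages: $\overrightarrow\eta^\ell_s(x)=\frac1\ell\sum_{y=x+1}^{x+\ell}\eta^N_s(y)$ and $\overleftarrow\eta^\ell_s(x)=\frac1\ell\sum_{y=x-\ell}^{x-1}\eta^N_s(y)$; when $\ell$ is not an integer it is replaced by $\lceil\ell\rceil$. *)

theory Defs
  imports "HOL-Probability.Probability"
begin

section \<open>Markov processes on a finite state space\<close>

text \<open>
  The semigroup $e^{tG}$ of a generator $G$ on a finite state space $S$, as the exponential series.
  Functions on $S$ are represented by functions on the whole type; this is harmless as long as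
  the values of $G f$ on $S$ depend on those of $f$ on $S$ only.
\<close>

definition semigroup_of :: "(('s \<Rightarrow> real) \<Rightarrow> 's \<Rightarrow> real) \<Rightarrow> real \<Rightarrow> ('s \<Rightarrow> real) \<Rightarrow> 's \<Rightarrow> real" where
  "semigroup_of G t f a = (\<Sum>n. t ^ n / fact n * (G ^^ n) f a)"

text \<open>
  The Markov property is stated for the finite-dimensional distributions, with transition
  probabilities $P_t(a,b) = (e^{tG} 1_{\{b\}})(a)$ and multiplied out, so that conditioning events
  of probability zero need no separate treatment.  The paths are right-continuous with left limits
  for the discrete topology on $S$.
\<close>

definition markov_process ::
  "'w measure \<Rightarrow> 's set \<Rightarrow> (('s \<Rightarrow> real) \<Rightarrow> 's \<Rightarrow> real) \<Rightarrow> 's measure \<Rightarrow> (real \<Rightarrow> 'w \<Rightarrow> 's) \<Rightarrow> bool" where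
  "markov_process M S G \<mu> X \<longleftrightarrow>
     prob_space M \<and>
     (\<forall>t\<ge>0. X t \<in> measurable M (count_space S)) \<and>
     distr M (count_space S) (X 0) = \<mu> \<and>
     (\<forall>(n::nat) (t::nat \<Rightarrow> real) (a::nat \<Rightarrow> 's).
        0 \<le> t 0 \<and> (\<forall>i\<le>n. t i \<le> t (Suc i)) \<and> (\<forall>i\<le>Suc n. a i \<in> S) \<longrightarrow>
        measure M {\<omega> \<in> space M. \<forall>i\<le>Suc n. X (t i) \<omega> = a i} =
        measure M {\<omega> \<in> space M. \<forall>i\<le>n. X (t i) \<omega> = a i} *
          semigroup_of G (t (Suc n) - t n) (indicator {a (Suc n)}) (a n)) \<and>
     (\<forall>\<omega>\<in>space M.
        (\<forall>t\<ge>0. \<forall>\<^sub>F s in at_right t. X s \<omega> = X t \<omega>) \<and>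
        (\<forall>t>0. \<exists>a. \<forall>\<^sub>F s in at_left t. X s \<omega> = a))"

section \<open>Exclusion with long jumps and infinitely extended reservoirs\<close>

type_synonym config = "int \<Rightarrow> nat"

definition c_gamma :: "real \<Rightarrow> real" where
  "c_gamma \<gamma> = inverse (\<Sum>\<^sub>\<infinity>z\<in>UNIV - {0::int}. real_of_int \<bar>z\<bar> powr (- \<gamma> - 1))"

definition jump_prob :: "real \<Rightarrow> int \<Rightarrow> real" where
  "jump_prob \<gamma> z = (if z = 0 then 0 else c_gamma \<gamma> * real_of_int \<bar>z\<bar> powr (- \<gamma> - 1))"

definition bulk :: "nat \<Rightarrow> int set" where
  "bulk N = {1..int N - 1}"

definition configs :: "nat \<Rightarrow> config set" where
  "configs N = (\<Pi>\<^sub>E x\<in>bulk N. {0, 1})"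

definition swap :: "int \<Rightarrow> int \<Rightarrow> config \<Rightarrow> config" where
  "swap x y \<eta> = \<eta>(x := \<eta> y, y := \<eta> x)"

definition flip :: "int \<Rightarrow> config \<Rightarrow> config" where
  "flip x \<eta> = \<eta>(x := 1 - \<eta> x)"

definition flip_rate :: "int \<Rightarrow> config \<Rightarrow> real \<Rightarrow> real" where
  "flip_rate x \<eta> \<delta> = real (\<eta> x) * (1 - \<delta>) + (1 - real (\<eta> x)) * \<delta>"

definition generator ::
  "real \<Rightarrow> real \<Rightarrow> real \<Rightarrow> real \<Rightarrow> real \<Rightarrow> nat \<Rightarrow> (config \<Rightarrow> real) \<Rightarrow> config \<Rightarrow> real" where
  "generator \<gamma> \<theta> \<kappa> \<alpha> \<beta> N f \<eta> =
     1 / 2 * (\<Sum>x\<in>bulk N. \<Sum>y\<in>bulk N. jump_prob \<gamma> (x - y) * (f (swap x y \<eta>) - f \<eta>))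
     + \<kappa> / real N powr \<theta> *
       (\<Sum>x\<in>bulk N. \<Sum>\<^sub>\<infinity>y\<in>{..0}. jump_prob \<gamma> (x - y) * flip_rate x \<eta> \<alpha> * (f (flip x \<eta>) - f \<eta>))
     + \<kappa> / real N powr \<theta> *
       (\<Sum>x\<in>bulk N. \<Sum>\<^sub>\<infinity>y\<in>{int N..}. jump_prob \<gamma> (x - y) * flip_rate x \<eta> \<beta> * (f (flip x \<eta>) - f \<eta>))"

definition accelerated_generator ::
  "real \<Rightarrow> real \<Rightarrow> real \<Rightarrow> real \<Rightarrow> real \<Rightarrow> nat \<Rightarrow> (config \<Rightarrow> real) \<Rightarrow> config \<Rightarrow> real" where
  "accelerated_generator \<gamma> \<theta> \<kappa> \<alpha> \<beta> N f \<eta> = real N powr \<gamma> * generator \<gamma> \<theta> \<kappa> \<alpha> \<beta> N f \<eta>"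

text \<open>
  Elements of \<^term>\<open>configs N\<close> have no meaningful value outside \<^term>\<open>bulk N\<close>, so the averages below are
  meaningful only when the window lies inside the bulk.  For windows of length $\lceil\epsilon N\rceil$ at
  the boundary this holds for every $\epsilon < 1$ and all large $N$.
\<close>

definition right_average :: "real \<Rightarrow> config \<Rightarrow> int \<Rightarrow> real" where
  "right_average l \<eta> x = (\<Sum>y\<in>{x + 1..x + \<lceil>l\<rceil>}. real (\<eta> y)) / real_of_int \<lceil>l\<rceil>"

definition left_average :: "real \<Rightarrow> config \<Rightarrow> int \<Rightarrow> real" where
  "left_average l \<eta> x = (\<Sum>y\<in>{x - \<lceil>l\<rceil>..x - 1}. real (\<eta> y)) / real_of_int \<lceil>l\<rceil>"

end

theory Submission imports Defs begin

text \<open>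
  The occupation variables are closed under the generator: it maps $\eta(y)$ to an affine function
  of $\eta$.  With $V = \alpha - \overrightarrow\eta^\ell(0)$, the functions
  $U_t(y) = \mathbb E[V(\eta_s)(\alpha - \eta_t(y))]$, $t \ge s$, therefore solve a linear equation, and
  $W(y) = W_s(y) = \int_s^T U_t(y)\,dt$ solves a discrete elliptic equation with bounded right-hand side, killing
  $\kappa N^{-\theta}(r^-+r^+)$ and a source proportional to $r^+$.  Testing it with
  $J(x) = W(x) - b\,x/N$, where $b$ is chosen so that the source is absorbed near the right boundary,
  bounds the Dirichlet form plus the killing term by $C N^{1-\gamma}$.  The killing at $x = 1$ gives
  $J(1)^2 \le C N^{1+\theta-\gamma} \to 0$, and a comparison of the means over blocks of length $n$ and
  $n/2$, iterated down to $n = 1$, gives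
  $|J(1) - \frac1\ell\sum_{x\le\ell} J(x)| \le C(\ell/N)^{(\gamma-1)/2}$.  Finally
  $\mathbb E[(\int_0^T V(\eta_s)\,ds)^2] = 2\int_0^T \frac1\ell\sum_{x\le\ell} W_s(x)\,ds$ is small.
  The right boundary reduces to the left one by the reflection $x \mapsto N - x$.
\<close>

section \<open>Reservoir rates\<close>

text \<open>Everything aims at a Dirichlet form D of \<open>J\<close> of order N^(1-\<gamma>). Means
  over blocks of length l differ from J(1) by at most C sqrt(D l^(\<gamma>-1)), so this is the order
  that makes the difference small for l = \<epsilon>N. Dividing it by the killing strength \<kappa>
  N^(-\<theta>) at site 1 bounds J(1)^2 by a multiple of N^(\<theta>+1-\<gamma>), which vanishes
  because \<theta> < \<gamma> - 1. The obstacle is the source at the far boundary: tested against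
  \<open>W\<close> itself it may contribute order N^(-\<theta>), far above N^(1-\<gamma>). But
  \<open>W\<close> is pulled to 0 by the left reservoir and to b by the right one, and the line b
  x/N matches both values; its own Dirichlet form is O(N^(1-\<gamma>)) because \<gamma> < 2. The
  condition \<gamma> > 1 lets the Dirichlet form control a single site: the errors of successive
  halvings form a convergent geometric series. The time increments of U have size N^(-\<gamma>)
  after division by the acceleration, hence total mass O(N^(1-\<gamma>)) over the N sites. No
  reference measure enters, so the initial law is arbitrary.\<close>

lemma powr_tail_step:
  fixes g x :: real
  assumes "0 < g" "1 \<le> x"
  shows "x powr (- g - 1) \<le> 2 powr (g + 1) / g * (x powr - g - (x + 1) powr - g)"
proof -
  have "\<exists>z>x. z < x + 1 \<and> (x + 1) powr - g - x powr - g = (x + 1 - x) * ((- g) * z powr (- g - 1))"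
    by (rule MVT2) (use assms in \<open>auto intro!: derivative_eq_intros\<close>)
  then obtain z where z: "x < z" "z < x + 1" and eq: "(x + 1) powr - g - x powr - g = - g * z powr (- g - 1)"
    by auto
  \<comment> \<open>\<open>z < x + 1\<close> and \<open>1 \<le> x\<close> give
    \<open>z \<le> 2 * x\<close>; the factor \<open>2 powr (g + 1)\<close> is the price of moving
    the derivative from \<open>z\<close> back to \<open>x\<close>.\<close>
  have "(2 * x) powr (- g - 1) \<le> z powr (- g - 1)"
    by (rule powr_mono2') (use assms z in auto)
  moreover have "(2 * x) powr (- g - 1) = x powr (- g - 1) / 2 powr (g + 1)"
  proof -
    have "(2::real) powr (- g - 1) = 1 / 2 powr (g + 1)"
      using powr_minus_divide[of 2 "g + 1"] by (simp only: minus_add_distrib diff_conv_add_uminus)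
    then show ?thesis using assms by (simp add: powr_mult)
  qed
  ultimately have "x powr (- g - 1) \<le> 2 powr (g + 1) * z powr (- g - 1)"
    by (simp add: pos_divide_le_eq mult.commute)
  also have "z powr (- g - 1) = (x powr - g - (x + 1) powr - g) / g"
    using assms eq by (simp add: field_simps)
  finally show ?thesis by simp
qed

text \<open>The differences in \<open>powr_tail_step\<close> telescope to \<open>x powr - g\<close>,
  which yields convergence and the bound at once.\<close>

lemma powr_tail_sum:
  fixes g :: real and x :: int
  assumes "0 < g" "1 \<le> x"
  shows "summable (\<lambda>n. real_of_int (x + int n) powr (- g - 1))"
    and "(\<Sum>n. real_of_int (x + int n) powr (- g - 1)) \<le> 2 powr (g + 1) / g * real_of_int x powr - g"
proof -
  let ?c = "2 powr (g + 1) / g"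
  let ?u = "\<lambda>n. (real_of_int x + real n) powr - g"
  have "filterlim (\<lambda>n. real_of_int x + real n) at_top sequentially"
    by (intro filterlim_tendsto_add_at_top[OF tendsto_const] filterlim_real_sequentially)
  then have "?u \<longlonglongrightarrow> 0"
    using assms by (intro tendsto_neg_powr) auto
  from telescope_sums'[OF this]
  have s: "(\<lambda>n. ?c * (?u n - ?u (Suc n))) sums (?c * real_of_int x powr - g)"
    by (intro sums_mult) simp
  have le: "real_of_int (x + int n) powr (- g - 1) \<le> ?c * (?u n - ?u (Suc n))" for n
    using powr_tail_step[of g "real_of_int x + real n"] assms by (simp add: algebra_simps)
  show sm: "summable (\<lambda>n. real_of_int (x + int n) powr (- g - 1))"
    by (rule summable_comparison_test'[OF sums_summable[OF s], of 0]) (use le in auto)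
  show "(\<Sum>n. real_of_int (x + int n) powr (- g - 1)) \<le> ?c * real_of_int x powr - g"
    using suminf_le[OF le sm sums_summable[OF s]] sums_unique[OF s] by simp
qed

text \<open>Comparison with the integral of the decreasing function x^(1-g), one unit interval at a
  time; g < 2 makes it integrable at 0.\<close>

lemma powr_sum_le:
  fixes g :: real
  assumes "1 < g" "g < 2"
  shows "(\<Sum>x\<in>{1..int n}. real_of_int x powr (1 - g)) \<le> real n powr (2 - g) / (2 - g)"
proof (induction n)
  case (Suc n)
  \<comment> \<open>The first interval is treated apart because the derivative of x^(2-g) blows up
    at 0. There the claim is \<open>1 \<le> 1 / (2 - g)\<close>, with
    \<open>0 powr (2 - g) = 0\<close>.\<close>
  have *: "real (Suc n) powr (1 - g) \<le> (real (Suc n) powr (2 - g) - real n powr (2 - g)) / (2 - g)"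
  proof (cases "n = 0")
    case False
    have "\<exists>z>real n. z < real (Suc n) \<and> real (Suc n) powr (2 - g) - real n powr (2 - g)
        = (real (Suc n) - real n) * ((2 - g) * z powr (2 - g - 1))"
      by (rule MVT2) (use False in \<open>auto intro!: derivative_eq_intros\<close>)
    then obtain z where z: "real n < z" "z < real (Suc n)"
      and eq: "real (Suc n) powr (2 - g) - real n powr (2 - g) = (2 - g) * z powr (1 - g)"
      by auto
    have "real (Suc n) powr (1 - g) \<le> z powr (1 - g)"
      by (rule powr_mono2') (use assms z in auto)
    then have "(2 - g) * real (Suc n) powr (1 - g) \<le> (2 - g) * z powr (1 - g)"
      by (rule mult_left_mono) (use assms in auto)
    then show ?thesis using eq assms by (simp add: pos_le_divide_eq mult.commute)
  qed (use assms in auto)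
  have "{1..int (Suc n)} = insert (int (Suc n)) {1..int n}" by auto
  then have "(\<Sum>x\<in>{1..int (Suc n)}. real_of_int x powr (1 - g)) =
      real (Suc n) powr (1 - g) + (\<Sum>x\<in>{1..int n}. real_of_int x powr (1 - g))"
    by (simp add: add.commute)
  then show ?case using * Suc by (simp add: diff_divide_distrib)
qed (use assms in auto)

text \<open>Summability is the content: a divergent \<open>infsum\<close> is 0 by default, and so
  would be its inverse. Once the series converges, the single term \<open>z = 1\<close> makes it
  positive.\<close>

lemma c_gamma_pos:
  assumes "0 < g"
  shows "0 < c_gamma g"
proof -
  let ?f = "\<lambda>z::int. real_of_int \<bar>z\<bar> powr (- g - 1)"
  have eq: "UNIV - {0::int} = range (\<lambda>n. 1 + int n) \<union> range (\<lambda>n. - 1 - int n)"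
  proof -
    have "z \<in> range (\<lambda>n. 1 + int n)" if "z > 0" for z
      using that by (intro image_eqI[of _ _ "nat (z - 1)"]) auto
    moreover have "z \<in> range (\<lambda>n. - 1 - int n)" if "z < 0" for z
      using that by (intro image_eqI[of _ _ "nat (- z - 1)"]) auto
    ultimately show ?thesis by (auto, metis linorder_neqE)
  qed
  have base: "(\<lambda>n. real_of_int (1 + int n) powr (- g - 1)) summable_on UNIV"
    using powr_tail_sum(1)[of g 1] assms by (intro norm_summable_imp_summable_on) simp
  have "?f summable_on range (\<lambda>n. 1 + int n)"
    by (subst summable_on_reindex) (use base in \<open>auto simp: inj_on_def o_def abs_of_nonneg\<close>)
  moreover have "?f summable_on range (\<lambda>n. - 1 - int n)"
  proof (subst summable_on_reindex)
    have "(?f \<circ> (\<lambda>n. - 1 - int n)) = (\<lambda>n. real_of_int (1 + int n) powr (- g - 1))"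
      by (auto simp: fun_eq_iff abs_if add.commute)
    then show "(?f \<circ> (\<lambda>n. - 1 - int n)) summable_on UNIV" using base by simp
  qed (auto simp: inj_on_def)
  ultimately have sm: "?f summable_on UNIV - {0}"
    unfolding eq by (rule summable_on_union)
  have "(\<Sum>\<^sub>\<infinity>z\<in>{1}. ?f z) \<le> (\<Sum>\<^sub>\<infinity>z\<in>UNIV - {0}. ?f z)"
    by (rule infsum_mono2) (use sm in auto)
  then show ?thesis unfolding c_gamma_def by simp
qed

section \<open>Total jump rates into the reservoirs\<close>

definition reservoir_rate :: "real \<Rightarrow> int \<Rightarrow> real" where
  "reservoir_rate g x = (\<Sum>\<^sub>\<infinity>y\<in>{..0}. jump_prob g (x - y))"

lemma jump_prob_minus [simp]: "jump_prob g (- z) = jump_prob g z"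
  by (simp add: jump_prob_def)

lemma jump_prob_commute: "jump_prob g (x - y) = jump_prob g (y - x)"
  using jump_prob_minus[of g "x - y"] by simp

lemma jump_prob_nonneg: "0 < g \<Longrightarrow> 0 \<le> jump_prob g z"
  using c_gamma_pos[of g] by (simp add: jump_prob_def)

text \<open>The reflection y -> N - y carries the right reservoir to the left one, so one function
  serves for both: r^-(x) is \<open>reservoir_rate g x\<close> and r^+(x) is
  \<open>reservoir_rate g (int N - x)\<close>.\<close>

lemma reservoir_rate_right:
  "(\<Sum>\<^sub>\<infinity>y\<in>{int N..}. jump_prob g (x - y)) = reservoir_rate g (int N - x)"
  unfolding reservoir_rate_def
proof (rule infsum_reindex_bij_witness[of _ "\<lambda>y. int N - y" "\<lambda>y. int N - y"])
  fix y :: int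
  have "int N - x - (int N - y) = - (x - y)" by simp
  then show "jump_prob g (int N - x - (int N - y)) = jump_prob g (x - y)"
    by (simp only: jump_prob_minus)
qed auto

text \<open>The lower bound keeps only the reservoir site 0. At x = 1 it equals
  \<open>c_gamma g\<close>, independently of N: this is the killing that ties \<open>J\<close> down
  at the boundary. The upper bound feeds the first moment of the rate.\<close>

lemma reservoir_rate_bounds:
  assumes "0 < g" "1 \<le> x"
  shows "jump_prob g x \<le> reservoir_rate g x"
    and "reservoir_rate g x \<le> c_gamma g * (2 powr (g + 1) / g) * real_of_int x powr - g"
proof -
  let ?f = "\<lambda>n. jump_prob g (x + int n)"
  have f: "?f = (\<lambda>n. c_gamma g * real_of_int (x + int n) powr (- g - 1))"
    using assms by (auto simp: jump_prob_def fun_eq_iff)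
  have sm: "summable ?f"
    unfolding f using powr_tail_sum(1)[OF assms] by (rule summable_mult)
  have "(\<Sum>\<^sub>\<infinity>y\<in>{..0}. jump_prob g (x - y)) = (\<Sum>\<^sub>\<infinity>n. ?f n)"
    by (rule infsum_reindex_bij_witness[of _ "\<lambda>n. - int n" "\<lambda>y. nat (- y)"]) auto
  also have "\<dots> = (\<Sum>n. ?f n)"
    by (rule infsumI, rule norm_summable_imp_has_sum)
      (use sm assms jump_prob_nonneg in \<open>auto intro: summable_sums\<close>)
  finally have eq: "reservoir_rate g x = (\<Sum>n. ?f n)" by (simp add: reservoir_rate_def)
  have "(\<Sum>n\<in>{0}. ?f n) \<le> (\<Sum>n. ?f n)"
    by (rule sum_le_suminf) (use sm assms jump_prob_nonneg in auto)
  then show "jump_prob g x \<le> reservoir_rate g x" using eq by simp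
  have "reservoir_rate g x = c_gamma g * (\<Sum>n. real_of_int (x + int n) powr (- g - 1))"
    unfolding eq f by (rule suminf_mult) (use powr_tail_sum(1)[OF assms] in auto)
  also have "\<dots> \<le> c_gamma g * (2 powr (g + 1) / g * real_of_int x powr - g)"
    by (rule mult_left_mono) (use powr_tail_sum(2)[OF assms] c_gamma_pos assms in \<open>auto intro: less_imp_le\<close>)
  finally show "reservoir_rate g x \<le> c_gamma g * (2 powr (g + 1) / g) * real_of_int x powr - g"
    by simp
qed

section \<open>Energy estimate\<close>

text \<open>Symmetrisation: by symmetry of \<open>p\<close> the sum is unchanged when
  \<open>x\<close> and \<open>y\<close> are exchanged, and the average of the two versions is the
  bilinear form.\<close>

lemma dirichlet_by_parts:
  fixes p :: "int \<Rightarrow> int \<Rightarrow> real"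
  assumes "\<And>x y. p x y = p y x"
  shows "(\<Sum>x\<in>S. J x * (\<Sum>y\<in>S. p x y * (W y - W x)))
    = - (\<Sum>x\<in>S. \<Sum>y\<in>S. p x y * ((J x - J y) * (W x - W y))) / 2"
proof -
  let ?a = "\<Sum>x\<in>S. \<Sum>y\<in>S. p x y * (J x * (W y - W x))"
  have "?a = (\<Sum>y\<in>S. \<Sum>x\<in>S. p x y * (J x * (W y - W x)))"
    by (rule sum.swap)
  also have "\<dots> = (\<Sum>x\<in>S. \<Sum>y\<in>S. p x y * (J y * (W x - W y)))"
    by (intro sum.cong refl) (metis assms)
  finally have "2 * ?a = (\<Sum>x\<in>S. \<Sum>y\<in>S. p x y * (J x * (W y - W x)) + p x y * (J y * (W x - W y)))"
    by (simp add: sum.distrib)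
  also have "\<dots> = (\<Sum>x\<in>S. \<Sum>y\<in>S. - (p x y * ((J x - J y) * (W x - W y))))"
    by (intro sum.cong refl) (simp add: algebra_simps)
  finally have "2 * ?a = - (\<Sum>x\<in>S. \<Sum>y\<in>S. p x y * ((J x - J y) * (W x - W y)))"
    by (simp add: sum_negf)
  moreover have "(\<Sum>x\<in>S. J x * (\<Sum>y\<in>S. p x y * (W y - W x))) = ?a"
    by (simp add: sum_distrib_left mult_ac)
  ultimately show ?thesis by simp
qed

definition dirichlet :: "real \<Rightarrow> nat \<Rightarrow> (int \<Rightarrow> real) \<Rightarrow> real" where
  "dirichlet g N J = (\<Sum>x\<in>bulk N. \<Sum>y\<in>bulk N. jump_prob g (x - y) * (J x - J y)\<^sup>2) / 2"

lemma dirichlet_nonneg: "0 < g \<Longrightarrow> 0 \<le> dirichlet g N J"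
  unfolding dirichlet_def by (intro divide_nonneg_nonneg sum_nonneg mult_nonneg_nonneg jump_prob_nonneg) auto

text \<open>For g < 2 the jump law has infinite variance, and truncation at range N leaves a second
  moment of order N^(2-g). Divided by N^2 and summed over N sites, this is the Dirichlet form of
  x/N, of order N^(1-g).\<close>

lemma jump_second_moment:
  assumes "1 < g" "g < 2" "x \<in> bulk N"
  shows "(\<Sum>y\<in>bulk N. jump_prob g (x - y) * (real_of_int (x - y))\<^sup>2)
    \<le> 2 * c_gamma g / (2 - g) * real N powr (2 - g)"
proof -
  let ?f = "\<lambda>z::int. c_gamma g * real_of_int z powr (1 - g)"
  have c: "0 < c_gamma g" using assms by (intro c_gamma_pos) auto
  have t: "jump_prob g z * (real_of_int z)\<^sup>2 = ?f \<bar>z\<bar>" for z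
  proof (cases "z = 0")
    case False
    have "real_of_int \<bar>z\<bar> powr (1 - g) = real_of_int \<bar>z\<bar> powr ((- g - 1) + 2)" by simp
    also have "\<dots> = real_of_int \<bar>z\<bar> powr (- g - 1) * real_of_int \<bar>z\<bar> powr 2"
      by (rule powr_add)
    also have "real_of_int \<bar>z\<bar> powr 2 = (real_of_int z)\<^sup>2"
      using False powr_realpow[of "real_of_int \<bar>z\<bar>" 2] by simp
    finally show ?thesis using False by (simp add: jump_prob_def)
  qed (simp add: jump_prob_def)
  have s: "(\<Sum>z\<in>{1..int N}. ?f z) \<le> c_gamma g * (real N powr (2 - g) / (2 - g))"
    using mult_left_mono[OF powr_sum_le[OF assms(1,2), of N] less_imp_le[OF c]]
    by (simp add: sum_distrib_left)
  have "(\<Sum>y\<in>bulk N. jump_prob g (x - y) * (real_of_int (x - y))\<^sup>2) = (\<Sum>y\<in>bulk N. ?f \<bar>x - y\<bar>)"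
    by (simp only: t)
  also have "\<dots> \<le> (\<Sum>y\<in>{1..<x}. ?f \<bar>x - y\<bar>) + (\<Sum>y\<in>{x<..int N - 1}. ?f \<bar>x - y\<bar>)"
  proof -
    \<comment> \<open>The diagonal term \<open>y = x\<close> drops out because
      \<open>0 powr (1 - g) = 0\<close>.\<close>
    have "bulk N = insert x ({1..<x} \<union> {x<..int N - 1})"
      using assms by (auto simp: bulk_def)
    then have "(\<Sum>y\<in>bulk N. ?f \<bar>x - y\<bar>) = (\<Sum>y\<in>{1..<x} \<union> {x<..int N - 1}. ?f \<bar>x - y\<bar>)"
      by simp
    also have "\<dots> = (\<Sum>y\<in>{1..<x}. ?f \<bar>x - y\<bar>) + (\<Sum>y\<in>{x<..int N - 1}. ?f \<bar>x - y\<bar>)"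
      by (rule sum.union_disjoint) auto
    finally show ?thesis by simp
  qed
  also have "(\<Sum>y\<in>{1..<x}. ?f \<bar>x - y\<bar>) = (\<Sum>z\<in>{1..<x}. ?f z)"
    by (rule sum.reindex_bij_witness[of _ "\<lambda>z. x - z" "\<lambda>z. x - z"]) auto
  also have "\<dots> \<le> (\<Sum>z\<in>{1..int N}. ?f z)"
    by (rule sum_mono2) (use c assms in \<open>auto simp: bulk_def\<close>)
  also have "(\<Sum>y\<in>{x<..int N - 1}. ?f \<bar>x - y\<bar>) = (\<Sum>z\<in>{1..int N - 1 - x}. ?f z)"
    by (rule sum.reindex_bij_witness[of _ "\<lambda>z. x + z" "\<lambda>z. z - x"]) auto
  also have "\<dots> \<le> (\<Sum>z\<in>{1..int N}. ?f z)"
    by (rule sum_mono2) (use c assms in \<open>auto simp: bulk_def\<close>)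
  finally show ?thesis using s by simp
qed

text \<open>The rate decays like x^(-g), so its first moment is a sum of x^(1-g). The weights x/N
  and 1 - x/N that the corrector puts in front of the rates thus turn a mass of order 1 into one of
  order N^(1-g).\<close>

lemma reservoir_first_moment:
  assumes "1 < g" "g < 2"
  shows "(\<Sum>x\<in>bulk N. reservoir_rate g x * real_of_int x)
      \<le> c_gamma g * (2 powr (g + 1) / g) / (2 - g) * real N powr (2 - g)"
    and "(\<Sum>x\<in>bulk N. reservoir_rate g (int N - x) * (real N - real_of_int x))
      \<le> c_gamma g * (2 powr (g + 1) / g) / (2 - g) * real N powr (2 - g)"
proof -
  define R where "R = c_gamma g * (2 powr (g + 1) / g)"
  have R: "0 < R" using assms c_gamma_pos[of g] by (simp add: R_def)
  have "(\<Sum>x\<in>bulk N. reservoir_rate g x * real_of_int x) \<le> (\<Sum>x\<in>bulk N. R * real_of_int x powr (1 - g))"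
  proof (rule sum_mono)
    fix x assume "x \<in> bulk N"
    then have x: "1 \<le> x" by (simp add: bulk_def)
    then have "reservoir_rate g x * real_of_int x \<le> R * real_of_int x powr - g * real_of_int x"
      using reservoir_rate_bounds(2)[of g x] assms unfolding R_def by (intro mult_right_mono) auto
    also have "\<dots> = R * real_of_int x powr (1 - g)"
      using x powr_add[of "real_of_int x" "- g" 1] by (simp add: algebra_simps)
    finally show "reservoir_rate g x * real_of_int x \<le> R * real_of_int x powr (1 - g)" .
  qed
  also have "\<dots> \<le> (\<Sum>x\<in>{1..int N}. R * real_of_int x powr (1 - g))"
    by (rule sum_mono2) (use R in \<open>auto simp: bulk_def\<close>)
  also have "\<dots> \<le> R / (2 - g) * real N powr (2 - g)"
    using mult_left_mono[OF powr_sum_le[OF assms, of N] less_imp_le[OF R]]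
    by (simp add: sum_distrib_left)
  finally show 1: "(\<Sum>x\<in>bulk N. reservoir_rate g x * real_of_int x)
      \<le> c_gamma g * (2 powr (g + 1) / g) / (2 - g) * real N powr (2 - g)"
    unfolding R_def .
  have "(\<Sum>x\<in>bulk N. reservoir_rate g (int N - x) * (real N - real_of_int x))
    = (\<Sum>x\<in>bulk N. reservoir_rate g x * real_of_int x)"
    by (rule sum.reindex_bij_witness[of _ "\<lambda>z. int N - z" "\<lambda>z. int N - z"]) (auto simp: bulk_def)
  with 1 show "(\<Sum>x\<in>bulk N. reservoir_rate g (int N - x) * (real N - real_of_int x))
      \<le> c_gamma g * (2 powr (g + 1) / g) / (2 - g) * real N powr (2 - g)" by simp
qed

text \<open>
  The linear corrector in $J$ replaces the source $q b\,r^+(x)$, which has total mass of order $q$, by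
  $q b\,(1 - x/N)\,r^+(x)$ and $-q b\,(x/N)\,r^-(x)$, whose total masses are only $O(q N^{1-\gamma})$.
\<close>

definition energy_const :: "real \<Rightarrow> real \<Rightarrow> real \<Rightarrow> real" where
  "energy_const g \<kappa> T = T\<^sup>2 * c_gamma g / (2 - g)
     + 8 * \<kappa> * T\<^sup>2 * (c_gamma g * (2 powr (g + 1) / g)) / (2 - g) + 8 * T"

lemma energy_bound:
  fixes W G :: "int \<Rightarrow> real"
  assumes g: "1 < g" "g < 2" and N: "2 \<le> N" and q: "0 \<le> q" "q \<le> \<kappa>"
    and W: "\<And>x. x \<in> bulk N \<Longrightarrow> \<bar>W x\<bar> \<le> T" and b: "\<bar>b\<bar> \<le> T"
    and G: "\<And>x. x \<in> bulk N \<Longrightarrow> \<bar>G x\<bar> \<le> 2 * real N powr - g"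
    and eq: "\<And>x. x \<in> bulk N \<Longrightarrow>
      (\<Sum>y\<in>bulk N. jump_prob g (x - y) * (W y - W x))
        - q * (reservoir_rate g x + reservoir_rate g (int N - x)) * W x
        + q * b * reservoir_rate g (int N - x) = G x"
    and J: "\<And>x. J x = W x - b * (real_of_int x / real N)"
  shows "dirichlet g N J
      + 2 * q * (\<Sum>x\<in>bulk N. (reservoir_rate g x + reservoir_rate g (int N - x)) * (J x)\<^sup>2)
      \<le> energy_const g \<kappa> T * real N powr (1 - g)"
proof -
  let ?p = "\<lambda>x y. jump_prob g (x - y)" and ?r = "reservoir_rate g"
  let ?S = "bulk N"
  define c where "c = c_gamma g"
  define R where "R = c * (2 powr (g + 1) / g)"
  have c: "0 < c" using g unfolding c_def by (intro c_gamma_pos) auto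
  have R: "0 < R" using g c by (simp add: R_def)
  have T: "0 \<le> T" using b by linarith
  have r: "0 \<le> ?r x" "0 \<le> ?r (int N - x)" if "x \<in> ?S" for x
    using reservoir_rate_bounds(1)[of g x] reservoir_rate_bounds(1)[of g "int N - x"] that g
      jump_prob_nonneg[of g x] jump_prob_nonneg[of g "int N - x"] by (auto simp: bulk_def)
  have p: "0 \<le> ?p x y" for x y using g by (intro jump_prob_nonneg) auto
  have Jb: "\<bar>J x\<bar> \<le> 2 * T" if "x \<in> ?S" for x
  proof -
    have "\<bar>b * (real_of_int x / real N)\<bar> \<le> T * 1"
      unfolding abs_mult using that b N T by (intro mult_mono) (auto simp: bulk_def)
    then show ?thesis using W[OF that] unfolding J by linarith
  qed
  define D where "D = dirichlet g N J"
  define B where "B = q * (\<Sum>x\<in>?S. (?r x + ?r (int N - x)) * (J x)\<^sup>2)"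
  \<comment> \<open>By Young's inequality half of the form of \<open>J\<close> is spent on the
    increments of the corrector, whose own form is O(N^(1-g)) by \<open>jump_second_moment\<close>;
    the other half survives.\<close>
  have part1: "- (\<Sum>x\<in>?S. \<Sum>y\<in>?S. ?p x y * ((J x - J y) * (W x - W y))) / 2
      \<le> - D / 2 + T\<^sup>2 * c / (2 - g) * real N powr (1 - g) / 2"
  proof -
    have "- (?p x y * ((J x - J y) * (W x - W y))) \<le>
       - (?p x y * (J x - J y)\<^sup>2) / 2 + T\<^sup>2 / (real N)\<^sup>2 * (?p x y * (real_of_int (x - y))\<^sup>2) / 2" for x y
    proof -
      define z where "z = b * (real_of_int (x - y) / real N)"
      have Wz: "W x - W y = (J x - J y) + z"
        using N by (simp add: J z_def field_simps)
      have "z\<^sup>2 = b\<^sup>2 * ((real_of_int (x - y))\<^sup>2 / (real N)\<^sup>2)"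
        by (simp add: z_def power_mult_distrib power_divide)
      also have "\<dots> \<le> T\<^sup>2 * ((real_of_int (x - y))\<^sup>2 / (real N)\<^sup>2)"
        using b T by (intro mult_right_mono) (auto simp: abs_le_square_iff[symmetric])
      finally have z2: "z\<^sup>2 \<le> T\<^sup>2 / (real N)\<^sup>2 * (real_of_int (x - y))\<^sup>2" by simp
      have young: "- (u * (u + z)) \<le> - u\<^sup>2 / 2 + z\<^sup>2 / 2" for u :: real
        using zero_le_power2[of "u + z"] by (simp add: power2_eq_square field_simps)
      then have "- ((J x - J y) * (W x - W y)) \<le> - (J x - J y)\<^sup>2 / 2 + z\<^sup>2 / 2"
        unfolding Wz .
      also have "\<dots> \<le> - (J x - J y)\<^sup>2 / 2 + T\<^sup>2 / (real N)\<^sup>2 * (real_of_int (x - y))\<^sup>2 / 2"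
        using z2 by simp
      finally have "?p x y * (- ((J x - J y) * (W x - W y))) \<le>
        ?p x y * (- (J x - J y)\<^sup>2 / 2 + T\<^sup>2 / (real N)\<^sup>2 * (real_of_int (x - y))\<^sup>2 / 2)"
        using p by (rule mult_left_mono)
      then show ?thesis by (simp add: algebra_simps)
    qed
    then have "(\<Sum>x\<in>?S. \<Sum>y\<in>?S. - (?p x y * ((J x - J y) * (W x - W y)))) \<le>
      (\<Sum>x\<in>?S. \<Sum>y\<in>?S. - (?p x y * (J x - J y)\<^sup>2) / 2 + T\<^sup>2 / (real N)\<^sup>2 * (?p x y * (real_of_int (x - y))\<^sup>2) / 2)"
      by (intro sum_mono)
    also have "\<dots> = - D + T\<^sup>2 / (real N)\<^sup>2 / 2 * (\<Sum>x\<in>?S. \<Sum>y\<in>?S. ?p x y * (real_of_int (x - y))\<^sup>2)"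
      by (simp add: D_def dirichlet_def sum.distrib sum_negf sum_subtractf sum_distrib_left sum_divide_distrib)
    also have "\<dots> \<le> - D + T\<^sup>2 / (real N)\<^sup>2 / 2 * (real N * (2 * c / (2 - g) * real N powr (2 - g)))"
    proof -
      have "(\<Sum>x\<in>?S. \<Sum>y\<in>?S. ?p x y * (real_of_int (x - y))\<^sup>2) \<le> (\<Sum>x\<in>?S. 2 * c / (2 - g) * real N powr (2 - g))"
        unfolding c_def by (intro sum_mono jump_second_moment g)
      also have "\<dots> \<le> real N * (2 * c / (2 - g) * real N powr (2 - g))"
        unfolding sum_constant using c g by (intro mult_right_mono) (auto simp: bulk_def)
      finally show ?thesis by (intro add_left_mono mult_left_mono) auto
    qed
    also have "\<dots> = - D + T\<^sup>2 * c / (2 - g) * real N powr (1 - g)"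
    proof -
      have "real N powr (2 - g) = real N * real N powr (1 - g)"
        using N powr_add[of "real N" 1 "1 - g"] by simp
      then show ?thesis using N by (simp add: power2_eq_square)
    qed
    finally have *: "(\<Sum>x\<in>?S. \<Sum>y\<in>?S. - (?p x y * ((J x - J y) * (W x - W y))))
        \<le> - D + T\<^sup>2 * c / (2 - g) * real N powr (1 - g)" .
    show ?thesis
      using divide_right_mono[OF *, of 2] by (simp only: sum_negf add_divide_distrib)
  qed
  have N1: "real N powr (2 - g) / real N = real N powr (1 - g)"
    using N powr_diff[of "real N" "2 - g" 1] by simp
  \<comment> \<open>Here and in \<open>part3\<close> the sup bound on \<open>J\<close> suffices: the
    weight x/N, respectively 1 - x/N, is small at the boundary where the rate is large.\<close>
  have part2: "- (q * b * (\<Sum>x\<in>?S. ?r x * J x * (real_of_int x / real N)))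
      \<le> 2 * \<kappa> * T\<^sup>2 * R / (2 - g) * real N powr (1 - g)"
  proof -
    have "\<bar>\<Sum>x\<in>?S. ?r x * J x * (real_of_int x / real N)\<bar> \<le> (\<Sum>x\<in>?S. 2 * T / real N * (?r x * real_of_int x))"
    proof (rule order_trans[OF sum_abs], rule sum_mono)
      fix x assume x: "x \<in> ?S"
      have "\<bar>?r x * J x * (real_of_int x / real N)\<bar> = ?r x * (real_of_int x / real N) * \<bar>J x\<bar>"
        using r[OF x] x by (simp add: abs_mult bulk_def)
      also have "\<dots> \<le> ?r x * (real_of_int x / real N) * (2 * T)"
        using r[OF x] x Jb[OF x] by (intro mult_left_mono mult_nonneg_nonneg) (auto simp: bulk_def)
      finally show "\<bar>?r x * J x * (real_of_int x / real N)\<bar> \<le> 2 * T / real N * (?r x * real_of_int x)"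
        by (simp add: mult_ac)
    qed
    also have "\<dots> \<le> 2 * T / real N * (R / (2 - g) * real N powr (2 - g))"
      unfolding sum_distrib_left[symmetric] R_def c_def
      using T by (intro mult_left_mono reservoir_first_moment g) auto
    also have "\<dots> = 2 * T * R / (2 - g) * real N powr (1 - g)"
      unfolding N1[symmetric] by (simp add: mult_ac)
    finally have s: "\<bar>\<Sum>x\<in>?S. ?r x * J x * (real_of_int x / real N)\<bar> \<le> 2 * T * R / (2 - g) * real N powr (1 - g)" .
    have "\<bar>q * b * (\<Sum>x\<in>?S. ?r x * J x * (real_of_int x / real N))\<bar> \<le> \<kappa> * T * (2 * T * R / (2 - g) * real N powr (1 - g))"
      unfolding abs_mult using q b T s by (intro mult_mono mult_nonneg_nonneg) auto
    then show ?thesis by (simp add: power2_eq_square mult_ac)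
  qed
  have part3: "q * b * (\<Sum>x\<in>?S. ?r (int N - x) * J x * ((real N - real_of_int x) / real N))
      \<le> 2 * \<kappa> * T\<^sup>2 * R / (2 - g) * real N powr (1 - g)"
  proof -
    have "\<bar>\<Sum>x\<in>?S. ?r (int N - x) * J x * ((real N - real_of_int x) / real N)\<bar>
        \<le> (\<Sum>x\<in>?S. 2 * T / real N * (?r (int N - x) * (real N - real_of_int x)))"
    proof (rule order_trans[OF sum_abs], rule sum_mono)
      fix x assume x: "x \<in> ?S"
      have n: "0 \<le> (real N - real_of_int x) / real N" using x by (auto simp: bulk_def)
      have "\<bar>?r (int N - x) * J x * ((real N - real_of_int x) / real N)\<bar>
          = ?r (int N - x) * ((real N - real_of_int x) / real N) * \<bar>J x\<bar>"
        using r[OF x] n by (simp only: abs_mult abs_of_nonneg mult_ac)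
      also have "\<dots> \<le> ?r (int N - x) * ((real N - real_of_int x) / real N) * (2 * T)"
        using r[OF x] n Jb[OF x] by (intro mult_left_mono mult_nonneg_nonneg) auto
      finally show "\<bar>?r (int N - x) * J x * ((real N - real_of_int x) / real N)\<bar>
          \<le> 2 * T / real N * (?r (int N - x) * (real N - real_of_int x))"
        by (simp add: mult_ac)
    qed
    also have "\<dots> \<le> 2 * T / real N * (R / (2 - g) * real N powr (2 - g))"
      unfolding sum_distrib_left[symmetric] R_def c_def
      using T by (intro mult_left_mono reservoir_first_moment g) auto
    also have "\<dots> = 2 * T * R / (2 - g) * real N powr (1 - g)"
      unfolding N1[symmetric] by (simp add: mult_ac)
    finally have s: "\<bar>\<Sum>x\<in>?S. ?r (int N - x) * J x * ((real N - real_of_int x) / real N)\<bar>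
      \<le> 2 * T * R / (2 - g) * real N powr (1 - g)" .
    have "\<bar>q * b * (\<Sum>x\<in>?S. ?r (int N - x) * J x * ((real N - real_of_int x) / real N))\<bar>
      \<le> \<kappa> * T * (2 * T * R / (2 - g) * real N powr (1 - g))"
      unfolding abs_mult using q b T s by (intro mult_mono mult_nonneg_nonneg) auto
    then show ?thesis by (simp add: power2_eq_square mult_ac)
  qed
  have part4: "- (\<Sum>x\<in>?S. J x * G x) \<le> 4 * T * real N powr (1 - g)"
  proof -
    have "- (\<Sum>x\<in>?S. J x * G x) \<le> (\<Sum>x\<in>?S. \<bar>J x * G x\<bar>)"
      using sum_abs[of "\<lambda>x. J x * G x" ?S] by linarith
    also have "\<dots> \<le> (\<Sum>x\<in>?S. 2 * T * (2 * real N powr - g))"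
      unfolding abs_mult using Jb G T by (intro sum_mono mult_mono) auto
    also have "\<dots> \<le> real N * (2 * T * (2 * real N powr - g))"
      using T by (simp add: bulk_def mult_right_mono)
    also have "\<dots> = 4 * T * real N powr (1 - g)"
      using N powr_add[of "real N" 1 "- g"] by simp
    finally show ?thesis .
  qed
  \<comment> \<open>The bulk term keeps \<open>W\<close>; killing and source are rewritten through
    \<open>J\<close>. The cancellation for which the corrector is made is -(r^- + r^+) b x/N + b r^+
    = b (1 - x/N) r^+ - b (x/N) r^-.\<close>
  have "(\<Sum>x\<in>?S. J x * G x) = (\<Sum>x\<in>?S. J x * (\<Sum>y\<in>?S. ?p x y * (W y - W x))
      - q * ((?r x + ?r (int N - x)) * (J x)\<^sup>2) - q * b * (?r x * J x * (real_of_int x / real N))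
      + q * b * (?r (int N - x) * J x * ((real N - real_of_int x) / real N)))"
  proof (rule sum.cong[OF refl])
    fix x assume x: "x \<in> ?S"
    have W': "W x = J x + b * (real_of_int x / real N)" by (simp add: J)
    have N': "(real N - real_of_int x) / real N = 1 - real_of_int x / real N"
      using N by (simp add: field_simps)
    have "J x * G x = J x * (\<Sum>y\<in>?S. ?p x y * (W y - W x))
      - q * (?r x + ?r (int N - x)) * J x * (J x + b * (real_of_int x / real N))
      + q * b * ?r (int N - x) * J x"
      unfolding eq[OF x, symmetric] W'[symmetric] by (simp add: algebra_simps)
    then show "J x * G x = J x * (\<Sum>y\<in>?S. ?p x y * (W y - W x))
      - q * ((?r x + ?r (int N - x)) * (J x)\<^sup>2) - q * b * (?r x * J x * (real_of_int x / real N))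
      + q * b * (?r (int N - x) * J x * ((real N - real_of_int x) / real N))"
      unfolding N' by (simp add: power2_eq_square algebra_simps)
  qed
  also have "\<dots> = - (\<Sum>x\<in>?S. \<Sum>y\<in>?S. ?p x y * ((J x - J y) * (W x - W y))) / 2 - B
      - q * b * (\<Sum>x\<in>?S. ?r x * J x * (real_of_int x / real N))
      + q * b * (\<Sum>x\<in>?S. ?r (int N - x) * J x * ((real N - real_of_int x) / real N))"
    using dirichlet_by_parts[of ?p, where J = J and S = ?S and W = W] jump_prob_commute
    by (simp add: sum.distrib sum_subtractf sum_distrib_left B_def)
  finally have total: "(\<Sum>x\<in>?S. J x * G x) =
      - (\<Sum>x\<in>?S. \<Sum>y\<in>?S. ?p x y * ((J x - J y) * (W x - W y))) / 2 - B
      - q * b * (\<Sum>x\<in>?S. ?r x * J x * (real_of_int x / real N))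
      + q * b * (\<Sum>x\<in>?S. ?r (int N - x) * J x * ((real N - real_of_int x) / real N))" .
  \<comment> \<open>Solving the identity for D/2 + B and doubling gives the factors.
    \<open>P\<close> counts twice, for \<open>part2\<close> and \<open>part3\<close>, so
    \<open>4 * P\<close> and \<open>2 * Q\<close> become the terms with 8 \<kappa> T^2 and 8 T in
    \<open>energy_const\<close>.\<close>
  have "D + 2 * B \<le> U + 4 * P + 2 * Q"
    if "s = - x / 2 - B - y + z" "- x / 2 \<le> - D / 2 + U / 2" "- y \<le> P" "z \<le> P" "- s \<le> Q"
    for s x y z U P Q :: real
    using that by linarith
  from this[OF total part1 part2 part3 part4]
  have "D + 2 * B \<le> (T\<^sup>2 * c / (2 - g) + 8 * \<kappa> * T\<^sup>2 * R / (2 - g) + 8 * T) * real N powr (1 - g)"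
    by (simp add: distrib_right)
  then show ?thesis by (simp add: D_def B_def energy_const_def R_def c_def mult.assoc)
qed

section \<open>Block means\<close>

definition block_mean :: "(int \<Rightarrow> real) \<Rightarrow> nat \<Rightarrow> real" where
  "block_mean J n = (\<Sum>x\<in>{1..int n}. J x) / real n"

lemma block_mean_halving:
  assumes g: "1 < g" and n: "2 \<le> n" "n < N"
  shows "(block_mean J n - block_mean J (n div 2))\<^sup>2 \<le> 6 * dirichlet g N J / c_gamma g * real n powr (g - 1)"
proof -
  define h where "h = n div 2"
  define c where "c = c_gamma g"
  have c: "0 < c" using g unfolding c_def by (intro c_gamma_pos) auto
  \<comment> \<open>\<open>n \<le> 3 * h\<close> is sharp at n = 3. It gives the 3 in the final
    constant 6 = 2 * 3, while the 2 undoes the half in \<open>dirichlet\<close>.\<close>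
  have h: "1 \<le> h" "h \<le> n" "n \<le> 3 * h" using n by (auto simp: h_def)
  let ?A = "{1..int n}" and ?B = "{1..int h}"
  let ?p = "\<lambda>x y. jump_prob g (x - y)"
  have p0: "0 \<le> ?p x y" for x y using g by (intro jump_prob_nonneg) auto
  have "(\<Sum>(x, y)\<in>?A \<times> ?B. J x - J y) = real h * (\<Sum>x\<in>?A. J x) - real n * (\<Sum>y\<in>?B. J y)"
    by (simp add: sum.cartesian_product[symmetric] sum_subtractf sum_distrib_left)
  then have diff: "block_mean J n - block_mean J h = (\<Sum>(x, y)\<in>?A \<times> ?B. J x - J y) / (real n * real h)"
    using h n by (simp add: block_mean_def field_simps)
  have "(\<Sum>(x, y)\<in>?A \<times> ?B. J x - J y)\<^sup>2 \<le> (\<Sum>(x, y)\<in>?A \<times> ?B. (J x - J y)\<^sup>2) * real (card (?A \<times> ?B))"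
    using sum_squared_le_sum_of_squares[of "\<lambda>(x, y). J x - J y" "?A \<times> ?B"]
    by (simp add: case_prod_unfold)
  also have "(\<Sum>(x, y)\<in>?A \<times> ?B. (J x - J y)\<^sup>2) = (\<Sum>x\<in>?A. \<Sum>y\<in>?B. (J x - J y)\<^sup>2)"
    by (simp add: sum.cartesian_product)
  also have "\<dots> \<le> (\<Sum>x\<in>?A. \<Sum>y\<in>?B. real n powr (g + 1) / c * (?p x y * (J x - J y)\<^sup>2))"
  proof (intro sum_mono)
    fix x y assume xy: "x \<in> ?A" "y \<in> ?B"
    show "(J x - J y)\<^sup>2 \<le> real n powr (g + 1) / c * (?p x y * (J x - J y)\<^sup>2)"
    proof (cases "x = y")
      case False
      have "real n powr (- g - 1) \<le> real_of_int \<bar>x - y\<bar> powr (- g - 1)"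
        by (rule powr_mono2') (use g False xy h in auto)
      then have "real n powr (g + 1) * real n powr (- g - 1) \<le> real n powr (g + 1) * real_of_int \<bar>x - y\<bar> powr (- g - 1)"
        by (rule mult_left_mono) simp
      moreover have "real n powr (g + 1) * real n powr (- g - 1) = 1"
        using n by (simp add: powr_add[symmetric])
      ultimately have "1 \<le> real n powr (g + 1) / c * ?p x y"
        using False c by (simp add: jump_prob_def c_def[symmetric])
      from mult_right_mono[OF this, of "(J x - J y)\<^sup>2"] show ?thesis by (simp add: mult.assoc)
    qed simp
  qed
  also have "\<dots> = real n powr (g + 1) / c * (\<Sum>x\<in>?A. \<Sum>y\<in>?B. ?p x y * (J x - J y)\<^sup>2)"
    by (simp add: sum_distrib_left)
  also have "(\<Sum>x\<in>?A. \<Sum>y\<in>?B. ?p x y * (J x - J y)\<^sup>2) \<le> 2 * dirichlet g N J"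
  proof -
    have "(\<Sum>x\<in>?A. \<Sum>y\<in>?B. ?p x y * (J x - J y)\<^sup>2) \<le> (\<Sum>x\<in>?A. \<Sum>y\<in>bulk N. ?p x y * (J x - J y)\<^sup>2)"
      using h n p0 by (intro sum_mono sum_mono2) (auto simp: bulk_def)
    also have "\<dots> \<le> (\<Sum>x\<in>bulk N. \<Sum>y\<in>bulk N. ?p x y * (J x - J y)\<^sup>2)"
      using h n p0 by (intro sum_mono2 sum_nonneg) (auto simp: bulk_def)
    finally show ?thesis by (simp add: dirichlet_def)
  qed
  finally have sq: "(\<Sum>(x, y)\<in>?A \<times> ?B. J x - J y)\<^sup>2
      \<le> real n powr (g + 1) / c * (2 * dirichlet g N J) * (real n * real h)"
    using c by (simp add: mult_left_mono mult_right_mono divide_right_mono)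
  have "(block_mean J n - block_mean J h)\<^sup>2 \<le> real n powr (g + 1) / c * (2 * dirichlet g N J) / (real n * real h)"
  proof -
    define m where "m = real n * real h"
    have m: "0 < m" using h n by (simp add: m_def)
    have "(block_mean J n - block_mean J h)\<^sup>2
        \<le> real n powr (g + 1) / c * (2 * dirichlet g N J) * m / m\<^sup>2"
      using sq unfolding diff power_divide m_def[symmetric] by (rule divide_right_mono) simp
    also have "\<dots> = real n powr (g + 1) / c * (2 * dirichlet g N J) / m"
      using m by (simp add: power2_eq_square)
    finally show ?thesis unfolding m_def .
  qed
  also have "\<dots> \<le> real n powr (g + 1) / c * (2 * dirichlet g N J) / (real n * (real n / 3))"
    using h n c g dirichlet_nonneg[of g N J] by (intro divide_left_mono mult_left_mono) auto
  also have "\<dots> = 6 * dirichlet g N J / c * (real n powr (g + 1) / (real n)\<^sup>2)"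
    by (simp add: power2_eq_square)
  also have "real n powr (g + 1) / (real n)\<^sup>2 = real n powr (g - 1)"
    using n powr_diff[of "real n" "g + 1" 2] by (simp add: powr_numeral)
  finally show ?thesis by (simp add: h_def c_def)
qed

text \<open>Sum of the geometric series with ratio 2^(-(g-1)/2); equivalently the fixed point C = 1
  + C 2^(-(g-1)/2) that closes the induction over halvings.\<close>

definition chain_const :: "real \<Rightarrow> real" where
  "chain_const g = 1 / (1 - 2 powr - ((g - 1) / 2))"

lemma chain_const_pos: "1 < g \<Longrightarrow> 0 < chain_const g"
  using powr_less_mono[of "- ((g - 1) / 2)" 0 2] by (simp add: chain_const_def)

text \<open>Halving ends at the block {1}, whose mean is J(1). A halving at scale n costs a multiple
  of n^((g-1)/2), a positive power, so the largest scale dominates.\<close>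

lemma block_mean_minus_boundary:
  assumes g: "1 < g" and n: "1 \<le> n" "n < N"
  shows "\<bar>block_mean J n - J 1\<bar>
    \<le> chain_const g * sqrt (6 * dirichlet g N J / c_gamma g) * real n powr ((g - 1) / 2)"
  using n
proof (induction n rule: less_induct)
  case (less n)
  define K where "K = sqrt (6 * dirichlet g N J / c_gamma g)"
  define a where "a = (g - 1) / 2"
  have c: "0 < c_gamma g" using g by (intro c_gamma_pos) auto
  have K: "0 \<le> K" using dirichlet_nonneg[of g N J] g c by (simp add: K_def)
  have a: "0 < a" using g by (simp add: a_def)
  have cc: "0 < chain_const g" by (rule chain_const_pos[OF g])
  show ?case
  proof (cases "n = 1")
    case True
    then show ?thesis using K cc by (simp add: block_mean_def K_def[symmetric])
  next
    case False
    then have n2: "2 \<le> n" "n < N" using less.prems by auto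
    have "\<bar>block_mean J n - block_mean J (n div 2)\<bar> \<le> sqrt (6 * dirichlet g N J / c_gamma g * real n powr (g - 1))"
      using real_sqrt_le_mono[OF block_mean_halving[OF g n2]] by simp
    also have "\<dots> = K * real n powr a"
      by (simp only: real_sqrt_mult K_def a_def) (simp add: powr_half_sqrt_powr)
    finally have 1: "\<bar>block_mean J n - block_mean J (n div 2)\<bar> \<le> K * real n powr a" .
    have "\<bar>block_mean J (n div 2) - J 1\<bar> \<le> chain_const g * K * real (n div 2) powr a"
      using less.IH[of "n div 2"] n2 by (simp add: K_def a_def)
    also have "\<dots> \<le> chain_const g * K * (real n / 2) powr a"
      using cc K a by (intro mult_left_mono powr_mono2) auto
    also have "\<dots> = chain_const g * K * (2 powr - a * real n powr a)"
      by (simp add: powr_divide powr_minus_divide)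
    finally have "\<bar>block_mean J n - J 1\<bar> \<le> K * real n powr a * (1 + chain_const g * 2 powr - a)"
      using 1 by (simp add: algebra_simps)
    also have "1 + chain_const g * 2 powr - a = chain_const g"
    proof -
      have "2 powr - a < (1::real)" using a powr_less_mono[of "- a" 0 2] by simp
      then have "1 - 2 powr - a \<noteq> (0::real)" using a by simp
      then show ?thesis unfolding chain_const_def a_def[symmetric] by (simp add: field_simps)
    qed
    finally show ?thesis by (simp add: K_def a_def mult_ac)
  qed
qed

text \<open>The summands bound, in this order, |J(1)|, the distance from J(1) to the block mean of
  \<open>J\<close>, and the block mean of the corrector. The length \<open>l\<close> is real because
  the limit is taken along \<epsilon>N + 1.\<close>

definition block_bound :: "real \<Rightarrow> real \<Rightarrow> real \<Rightarrow> real \<Rightarrow> nat \<Rightarrow> real \<Rightarrow> real" where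
  "block_bound g \<theta> \<kappa> T N l =
     sqrt (energy_const g \<kappa> T * real N powr (\<theta> + 1 - g) / (2 * \<kappa> * c_gamma g))
     + chain_const g * sqrt (6 * energy_const g \<kappa> T / c_gamma g) * (l / real N) powr ((g - 1) / 2)
     + T * (l / real N)"

lemma block_mean_le_block_bound:
  fixes W G :: "int \<Rightarrow> real"
  assumes g: "1 < g" "g < 2" and N: "2 \<le> N" and \<theta>: "0 \<le> \<theta>" and \<kappa>: "0 < \<kappa>"
    and W: "\<And>x. x \<in> bulk N \<Longrightarrow> \<bar>W x\<bar> \<le> T" and b: "\<bar>b\<bar> \<le> T"
    and G: "\<And>x. x \<in> bulk N \<Longrightarrow> \<bar>G x\<bar> \<le> 2 * real N powr - g"
    and eq: "\<And>x. x \<in> bulk N \<Longrightarrow>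
      (\<Sum>y\<in>bulk N. jump_prob g (x - y) * (W y - W x))
        - \<kappa> / real N powr \<theta> * (reservoir_rate g x + reservoir_rate g (int N - x)) * W x
        + \<kappa> / real N powr \<theta> * b * reservoir_rate g (int N - x) = G x"
    and n: "1 \<le> n" "n < N"
  shows "\<bar>block_mean W n\<bar> \<le> block_bound g \<theta> \<kappa> T N (real n)"
proof -
  define q where "q = \<kappa> / real N powr \<theta>"
  define J where "J x = W x - b * (real_of_int x / real N)" for x
  define E where "E = energy_const g \<kappa> T"
  define c where "c = c_gamma g"
  have c: "0 < c" using g unfolding c_def by (intro c_gamma_pos) auto
  have N\<theta>: "1 \<le> real N powr \<theta>" using N \<theta> by (intro ge_one_powr_ge_zero) auto
  \<comment> \<open>This is where \<theta> \<ge> 0 enters: it bounds the reservoir strength by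
    \<kappa> uniformly in N.\<close>
  have q: "0 < q" "q \<le> \<kappa>" using N\<theta> \<kappa> N by (auto simp: q_def divide_le_eq_1 field_simps)
  let ?r = "reservoir_rate g"
  have r: "0 \<le> ?r x" "0 \<le> ?r (int N - x)" if "x \<in> bulk N" for x
    using reservoir_rate_bounds(1)[of g x] reservoir_rate_bounds(1)[of g "int N - x"] that g
      jump_prob_nonneg[of g x] jump_prob_nonneg[of g "int N - x"] by (auto simp: bulk_def)
  have en: "dirichlet g N J + 2 * q * (\<Sum>x\<in>bulk N. (?r x + ?r (int N - x)) * (J x)\<^sup>2) \<le> E * real N powr (1 - g)"
    unfolding E_def by (rule energy_bound[where W = W and b = b and G = G])
      (use g N q W b G eq in \<open>auto simp: q_def J_def\<close>)
  have B0: "0 \<le> (\<Sum>x\<in>bulk N. (?r x + ?r (int N - x)) * (J x)\<^sup>2)"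
    using r by (intro sum_nonneg) auto
  have D: "dirichlet g N J \<le> E * real N powr (1 - g)"
  proof -
    have "0 \<le> 2 * q * (\<Sum>x\<in>bulk N. (?r x + ?r (int N - x)) * (J x)\<^sup>2)" using q B0 by simp
    then show ?thesis using en by linarith
  qed
  have "\<bar>J 1\<bar> \<le> sqrt (E * real N powr (\<theta> + 1 - g) / (2 * \<kappa> * c))"
  proof -
    have one: "1 \<in> bulk N" using N by (simp add: bulk_def)
    \<comment> \<open>Of all killing terms only the left reservoir at site 1 is kept. Dividing by
      its strength \<kappa> N^(-\<theta>) turns N^(1-g) into N^(\<theta>+1-g).\<close>
    have "c * (J 1)\<^sup>2 \<le> (?r 1 + ?r (int N - 1)) * (J 1)\<^sup>2"
      using reservoir_rate_bounds(1)[of g 1] r[OF one] g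
      by (intro mult_right_mono) (auto simp: jump_prob_def c_def)
    also have "\<dots> \<le> (\<Sum>x\<in>bulk N. (?r x + ?r (int N - x)) * (J x)\<^sup>2)"
      using r one by (intro member_le_sum[of 1]) (auto simp: bulk_def)
    finally have "2 * q * (c * (J 1)\<^sup>2) \<le> 2 * q * (\<Sum>x\<in>bulk N. (?r x + ?r (int N - x)) * (J x)\<^sup>2)"
      using q by (intro mult_left_mono) auto
    also have "\<dots> \<le> E * real N powr (1 - g)"
      using en dirichlet_nonneg[of g N J] g by linarith
    finally have "(J 1)\<^sup>2 \<le> E * real N powr (1 - g) / (2 * q * c)"
      using q c by (simp add: pos_le_divide_eq mult_ac)
    also have "\<dots> = E * (real N powr (1 - g) * real N powr \<theta>) / (2 * \<kappa> * c)"
      using N by (simp add: q_def)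
    also have "real N powr (1 - g) * real N powr \<theta> = real N powr (\<theta> + 1 - g)"
      by (simp add: powr_add[symmetric] algebra_simps)
    finally show ?thesis using real_sqrt_le_mono by fastforce
  qed
  moreover have "\<bar>block_mean J n - J 1\<bar> \<le> chain_const g * sqrt (6 * E / c) * (real n / real N) powr ((g - 1) / 2)"
  proof -
    have "\<bar>block_mean J n - J 1\<bar> \<le> chain_const g * sqrt (6 * dirichlet g N J / c) * real n powr ((g - 1) / 2)"
      unfolding c_def by (rule block_mean_minus_boundary) (use g n in auto)
    also have "\<dots> \<le> chain_const g * sqrt (6 * (E * real N powr (1 - g)) / c) * real n powr ((g - 1) / 2)"
      using D c chain_const_pos[OF g(1)]
      by (intro mult_right_mono mult_left_mono real_sqrt_le_mono divide_right_mono) auto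
    also have "sqrt (6 * (E * real N powr (1 - g)) / c) = sqrt (6 * E / c) * sqrt (real N powr (1 - g))"
      by (simp add: real_sqrt_mult[symmetric])
    also have "sqrt (real N powr (1 - g)) = real N powr ((1 - g) / 2)"
      by (simp add: powr_half_sqrt_powr)
    also have "real N powr ((1 - g) / 2) = 1 / real N powr ((g - 1) / 2)"
      by (metis powr_minus_divide minus_diff_eq minus_divide_left)
    finally show ?thesis
      by (simp add: powr_divide)
  qed
  moreover have "\<bar>block_mean W n - block_mean J n\<bar> \<le> T * (real n / real N)"
  proof -
    have "block_mean W n - block_mean J n = (\<Sum>x\<in>{1..int n}. b * (real_of_int x / real N)) / real n"
      by (simp add: block_mean_def J_def sum_subtractf diff_divide_distrib)
    also have "\<bar>\<dots>\<bar> = \<bar>\<Sum>x\<in>{1..int n}. b * (real_of_int x / real N)\<bar> / real n"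
      by (simp add: abs_divide)
    also have "\<dots> \<le> (\<Sum>x\<in>{1..int n}. T * (real n / real N)) / real n"
    proof (rule divide_right_mono, rule order_trans[OF sum_abs], rule sum_mono)
      fix x assume x: "x \<in> {1..int n}"
      show "\<bar>b * (real_of_int x / real N)\<bar> \<le> T * (real n / real N)"
        unfolding abs_mult using x b by (intro mult_mono) (auto intro: divide_right_mono)
    qed simp
    also have "\<dots> = T * (real n / real N)" using n by simp
    finally show ?thesis .
  qed
  ultimately show ?thesis unfolding block_bound_def E_def c_def by linarith
qed

section \<open>Markov processes with a bounded generator on a finite set\<close>

text \<open>\<open>G\<close> acts on functions on the whole type although only \<open>S\<close>
  matters. \<open>G_bound\<close> says that \<open>G\<close> is a bounded operator over
  \<open>S\<close> and, with \<open>m = 0\<close>, that values outside \<open>S\<close> have no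
  influence on \<open>S\<close>.\<close>

locale bounded_generator =
  fixes S :: "'s set" and G :: "('s \<Rightarrow> real) \<Rightarrow> 's \<Rightarrow> real" and K :: real
  assumes finite_states: "finite S"
    and G_add: "G (\<lambda>a. f a + h a) = (\<lambda>a. G f a + G h a)"
    and G_scale: "G (\<lambda>a. c * f a) = (\<lambda>a. c * G f a)"
    and G_bound: "(\<And>a. a \<in> S \<Longrightarrow> \<bar>f a\<bar> \<le> m) \<Longrightarrow> a \<in> S \<Longrightarrow> \<bar>G f a\<bar> \<le> K * m"
begin

lemma power_add: "(G ^^ n) (\<lambda>a. f a + h a) = (\<lambda>a. (G ^^ n) f a + (G ^^ n) h a)"
  by (induction n) (simp_all add: G_add)

lemma power_scale: "(G ^^ n) (\<lambda>a. c * f a) = (\<lambda>a. c * (G ^^ n) f a)"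
  by (induction n) (simp_all add: G_scale)

lemma power_sum:
  "(G ^^ n) (\<lambda>a. \<Sum>b\<in>B. c b * f b a) = (\<lambda>a. \<Sum>b\<in>B. c b * (G ^^ n) (f b) a)"
proof (induction B rule: infinite_finite_induct)
  case (insert b B)
  then show ?case by (simp add: power_add power_scale)
\<comment> \<open>The zero function is 0 times any function; this settles the empty and the infinite
  index set.\<close>
qed (use power_scale[of n 0] in \<open>simp_all add: fun_eq_iff\<close>)

lemma power_bound:
  assumes "\<And>a. a \<in> S \<Longrightarrow> \<bar>f a\<bar> \<le> m" "a \<in> S"
  shows "\<bar>(G ^^ n) f a\<bar> \<le> K ^ n * m"
  using assms(2)
proof (induction n arbitrary: a)
  case (Suc n)
  then show ?case using G_bound[of "(G ^^ n) f" "K ^ n * m" a] by (simp add: mult.assoc)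
qed (use assms in simp)

text \<open>Linearity, and \<open>power_bound\<close> with bound 0 applied to the
  difference.\<close>

lemma power_cong:
  assumes "\<And>a. a \<in> S \<Longrightarrow> f a = h a" "a \<in> S"
  shows "(G ^^ n) f a = (G ^^ n) h a"
proof -
  have "(G ^^ n) (\<lambda>a. f a + - 1 * h a) a = (G ^^ n) f a + - 1 * (G ^^ n) h a"
    unfolding power_add power_scale ..
  moreover have "\<bar>(G ^^ n) (\<lambda>a. f a + - 1 * h a) a\<bar> \<le> K ^ n * 0"
    by (rule power_bound) (use assms in auto)
  ultimately show ?thesis by simp
qed

lemma semigroup_summable:
  assumes a: "a \<in> S"
  shows "summable (\<lambda>n. (G ^^ n) f a / fact n * t ^ n)"
proof (rule summable_comparison_test'[where N = 0])
  define m where "m = (\<Sum>a\<in>S. \<bar>f a\<bar>)"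
  have "\<bar>f a\<bar> \<le> m" if "a \<in> S" for a
    unfolding m_def by (rule member_le_sum[of _ _ "\<lambda>a. \<bar>f a\<bar>"]) (use that finite_states in auto)
  then have b: "\<bar>(G ^^ n) f a\<bar> \<le> K ^ n * m" for n by (rule power_bound) (use a in auto)
  show "summable (\<lambda>n. m * (inverse (fact n) * (\<bar>t\<bar> * K) ^ n))"
    by (intro summable_mult summable_exp)
  show "norm ((G ^^ n) f a / fact n * t ^ n) \<le> m * (inverse (fact n) * (\<bar>t\<bar> * K) ^ n)" for n
  proof -
    have "norm ((G ^^ n) f a / fact n * t ^ n) = \<bar>(G ^^ n) f a\<bar> * (inverse (fact n) * \<bar>t\<bar> ^ n)"
      by (simp add: abs_mult power_abs divide_inverse)
    also have "\<dots> \<le> K ^ n * m * (inverse (fact n) * \<bar>t\<bar> ^ n)"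
      by (intro mult_right_mono b) auto
    finally show ?thesis by (simp add: power_mult_distrib mult_ac)
  qed
qed

lemma semigroup_alt: "semigroup_of G t f a = (\<Sum>n. (G ^^ n) f a / fact n * t ^ n)"
  by (simp add: semigroup_of_def mult_ac)

text \<open>On \<open>S\<close> every function is a finite combination of point indicators. This
  leads from the transition probabilities in \<open>markov_process\<close> to arbitrary
  observables.\<close>

lemma semigroup_expand:
  assumes "a \<in> S"
  shows "semigroup_of G t f a = (\<Sum>b\<in>S. f b * semigroup_of G t (indicator {b}) a)"
proof -
  have "(G ^^ n) f a = (\<Sum>b\<in>S. f b * (G ^^ n) (indicator {b}) a)" for n
  proof -
    have "(G ^^ n) f a = (G ^^ n) (\<lambda>a. \<Sum>b\<in>S. f b * indicator {b} a) a"
      by (rule power_cong[OF _ assms])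
        (use finite_states in \<open>auto simp: indicator_def if_distrib[of "(*) _"] cong: if_cong\<close>)
    then show ?thesis unfolding power_sum .
  qed
  then have "semigroup_of G t f a = (\<Sum>n. \<Sum>b\<in>S. f b * ((G ^^ n) (indicator {b}) a / fact n * t ^ n))"
    unfolding semigroup_alt by (simp add: sum_distrib_right sum_divide_distrib mult.assoc)
  also have "\<dots> = (\<Sum>b\<in>S. \<Sum>n. f b * ((G ^^ n) (indicator {b}) a / fact n * t ^ n))"
    by (rule suminf_sum) (intro summable_mult semigroup_summable assms)
  also have "\<dots> = (\<Sum>b\<in>S. f b * semigroup_of G t (indicator {b}) a)"
    unfolding semigroup_alt by (intro sum.cong refl suminf_mult semigroup_summable assms)
  finally show ?thesis .
qed

text \<open>The derivative is written with \<open>G f\<close> inside the semigroup, so that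
  differentiating a correlation merely replaces the observable \<open>f\<close> by
  \<open>G f\<close>.\<close>

lemma semigroup_deriv:
  assumes "a \<in> S"
  shows "((\<lambda>t. semigroup_of G t f a) has_real_derivative semigroup_of G t (G f) a) (at t)"
proof -
  have "diffs (\<lambda>n. (G ^^ n) f a / fact n) = (\<lambda>n. (G ^^ n) (G f) a / fact n)"
    by (simp add: diffs_def fun_eq_iff funpow_swap1 del: of_nat_Suc)
  then show ?thesis
    unfolding semigroup_alt
    using termdiffs_strong_converges_everywhere[of "\<lambda>n. (G ^^ n) f a / fact n" t] semigroup_summable[OF assms, of f]
    by simp
qed

end

section \<open>Two-time correlations of a Markov process\<close>

context
  fixes M :: "'w measure" and S :: "'s set" and G :: "('s \<Rightarrow> real) \<Rightarrow> 's \<Rightarrow> real" and K :: real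
    and \<mu> :: "'s measure" and X :: "real \<Rightarrow> 'w \<Rightarrow> 's"
  assumes gen: "bounded_generator S G K" and markov: "markov_process M S G \<mu> X"
begin

interpretation bounded_generator S G K by (rule gen)

lemma markov_prob_space: "prob_space M"
  using markov by (simp add: markov_process_def)

interpretation prob_space M by (rule markov_prob_space)

lemma markov_measurable: "0 \<le> t \<Longrightarrow> X t \<in> measurable M (count_space S)"
  using markov by (simp add: markov_process_def)

lemma markov_state: "0 \<le> t \<Longrightarrow> \<omega> \<in> space M \<Longrightarrow> X t \<omega> \<in> S"
  using measurable_space[OF markov_measurable] by simp

lemma markov_observable_measurable:
  fixes f :: "'s \<Rightarrow> real"
  shows "0 \<le> t \<Longrightarrow> (\<lambda>\<omega>. f (X t \<omega>)) \<in> borel_measurable M"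
  by (rule measurable_compose[OF markov_measurable]) auto

lemma markov_observable_product_integrable:
  fixes v f :: "'s \<Rightarrow> real"
  assumes "0 \<le> s" "0 \<le> t"
  shows "integrable M (\<lambda>\<omega>. v (X s \<omega>) * f (X t \<omega>))"
proof (rule integrable_const_bound[where B = "(\<Sum>a\<in>S. \<bar>v a\<bar>) * (\<Sum>a\<in>S. \<bar>f a\<bar>)"])
  show "AE \<omega> in M. norm (v (X s \<omega>) * f (X t \<omega>)) \<le> (\<Sum>a\<in>S. \<bar>v a\<bar>) * (\<Sum>a\<in>S. \<bar>f a\<bar>)"
  proof (rule AE_I2)
    fix \<omega> assume w: "\<omega> \<in> space M"
    have "\<bar>u a\<bar> \<le> (\<Sum>a\<in>S. \<bar>u a\<bar>)" if "a \<in> S" for u :: "'s \<Rightarrow> real" and a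
      by (rule member_le_sum[of _ _ "\<lambda>a. \<bar>u a\<bar>"]) (use that finite_states in auto)
    then show "norm (v (X s \<omega>) * f (X t \<omega>)) \<le> (\<Sum>a\<in>S. \<bar>v a\<bar>) * (\<Sum>a\<in>S. \<bar>f a\<bar>)"
      using markov_state w assms by (auto simp: abs_mult intro!: mult_mono sum_nonneg)
  qed
qed (intro borel_measurable_times markov_observable_measurable assms)

lemma markov_two_times:
  assumes "0 \<le> s" "s \<le> t" "a \<in> S" "b \<in> S"
  shows "measure M {\<omega> \<in> space M. X s \<omega> = a \<and> X t \<omega> = b}
    = measure M {\<omega> \<in> space M. X s \<omega> = a} * semigroup_of G (t - s) (indicator {b}) a"
proof -
  let ?t = "\<lambda>i::nat. if i = 0 then s else t" and ?a = "\<lambda>i::nat. if i = 0 then a else b"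
  have "measure M {\<omega> \<in> space M. \<forall>i\<le>Suc 0. X (?t i) \<omega> = ?a i} =
        measure M {\<omega> \<in> space M. \<forall>i\<le>0. X (?t i) \<omega> = ?a i} *
          semigroup_of G (?t (Suc 0) - ?t 0) (indicator {?a (Suc 0)}) (?a 0)"
    using markov assms unfolding markov_process_def by (elim conjE allE[of _ ?t] allE[of _ ?a] allE[of _ 0]) auto
  moreover have "(\<forall>i\<le>Suc 0. P i) \<longleftrightarrow> P 0 \<and> P (Suc 0)" for P
    by (auto simp: le_Suc_eq)
  ultimately show ?thesis by simp
qed

text \<open>Summing two-time probabilities over both states leaves the law at time \<open>s\<close>
  and the semigroup, so all dependence on \<open>t\<close> sits in an everywhere convergent power
  series.\<close>

lemma markov_correlation:
  fixes v f :: "'s \<Rightarrow> real"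
  assumes "0 \<le> s" "s \<le> t"
  shows "(\<integral>\<omega>. v (X s \<omega>) * f (X t \<omega>) \<partial>M)
    = (\<Sum>a\<in>S. v a * measure M {\<omega> \<in> space M. X s \<omega> = a} * semigroup_of G (t - s) f a)"
proof -
  let ?E = "\<lambda>a b. {\<omega> \<in> space M. X s \<omega> = a \<and> X t \<omega> = b}"
  have sets: "?E a b \<in> sets M" for a b
  proof -
    have "{\<omega> \<in> space M. X r \<omega> = a} \<in> sets M" if "0 \<le> r" for r a
    proof (cases "a \<in> S")
      case True
      then have "X r -` {a} \<inter> space M \<in> sets M"
        by (intro measurable_sets[OF markov_measurable[OF that]]) auto
      moreover have "X r -` {a} \<inter> space M = {\<omega> \<in> space M. X r \<omega> = a}" by auto
      ultimately show ?thesis by simp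
    next
      case False
      then have "{\<omega> \<in> space M. X r \<omega> = a} = {}" using markov_state[OF that] by auto
      then show ?thesis by (simp only: sets.empty_sets)
    qed
    from sets.Int[OF this[of s a] this[of t b]] show ?thesis
      using assms by (simp add: Collect_conj_eq[symmetric] Int_def conj_ac cong: conj_cong)
  qed
  have "(\<integral>\<omega>. v (X s \<omega>) * f (X t \<omega>) \<partial>M) = (\<integral>\<omega>. (\<Sum>a\<in>S. \<Sum>b\<in>S. v a * f b * indicator (?E a b) \<omega>) \<partial>M)"
  proof (rule Bochner_Integration.integral_cong[OF refl])
    fix \<omega> assume w: "\<omega> \<in> space M"
    have "(\<Sum>a\<in>S. \<Sum>b\<in>S. v a * f b * indicator (?E a b) \<omega>)
      = (\<Sum>a\<in>S. \<Sum>b\<in>S. (if a = X s \<omega> then v a else 0) * (if b = X t \<omega> then f b else 0))"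
      by (intro sum.cong refl) (use w in \<open>auto simp: indicator_def\<close>)
    also have "\<dots> = (\<Sum>a\<in>S. if a = X s \<omega> then v a else 0) * (\<Sum>b\<in>S. if b = X t \<omega> then f b else 0)"
      by (simp only: sum_product)
    also have "\<dots> = v (X s \<omega>) * f (X t \<omega>)"
      using finite_states markov_state w assms by simp
    finally show "v (X s \<omega>) * f (X t \<omega>) = (\<Sum>a\<in>S. \<Sum>b\<in>S. v a * f b * indicator (?E a b) \<omega>)" ..
  qed
  also have "\<dots> = (\<Sum>a\<in>S. \<Sum>b\<in>S. v a * f b * measure M (?E a b))"
    using sets by (simp add: Bochner_Integration.integral_sum integrable_real_indicator emeasure_eq_measure)
  also have "\<dots> = (\<Sum>a\<in>S. \<Sum>b\<in>S. v a * f b * (measure M {\<omega> \<in> space M. X s \<omega> = a} * semigroup_of G (t - s) (indicator {b}) a))"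
    by (intro sum.cong refl) (simp add: markov_two_times[OF assms])
  also have "\<dots> = (\<Sum>a\<in>S. v a * measure M {\<omega> \<in> space M. X s \<omega> = a} * semigroup_of G (t - s) f a)"
    by (intro sum.cong refl, subst semigroup_expand[of _ _ f]) (auto simp: sum_distrib_left mult_ac)
  finally show ?thesis .
qed

text \<open>The semigroup formula holds from time \<open>s\<close> on; hence the derivative within
  \<open>{s..}\<close>, one-sided at \<open>t = s\<close>.\<close>

lemma markov_correlation_deriv:
  fixes v f :: "'s \<Rightarrow> real"
  assumes s: "0 \<le> s" "s \<le> t"
  shows "((\<lambda>t. \<integral>\<omega>. v (X s \<omega>) * f (X t \<omega>) \<partial>M) has_real_derivative
      (\<integral>\<omega>. v (X s \<omega>) * G f (X t \<omega>) \<partial>M)) (at t within {s..})"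
proof -
  let ?c = "\<lambda>a. v a * measure M {\<omega> \<in> space M. X s \<omega> = a}"
  have "((\<lambda>t. \<Sum>a\<in>S. ?c a * semigroup_of G (t - s) f a) has_real_derivative
      (\<Sum>a\<in>S. ?c a * (semigroup_of G (t - s) (G f) a * 1))) (at t)"
    by (intro DERIV_sum DERIV_cmult DERIV_chain'[OF _ semigroup_deriv]) (auto intro!: derivative_eq_intros)
  then have "((\<lambda>t. \<Sum>a\<in>S. ?c a * semigroup_of G (t - s) f a) has_real_derivative
      (\<integral>\<omega>. v (X s \<omega>) * G f (X t \<omega>) \<partial>M)) (at t within {s..})"
    unfolding markov_correlation[OF s] by (simp add: has_field_derivative_at_within)
  then show ?thesis
    unfolding has_field_derivative_def
    by (rule has_derivative_transform[rotated 2]) (use s markov_correlation[OF s(1)] in auto)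
qed

lemma markov_correlation_continuous:
  fixes v f :: "'s \<Rightarrow> real"
  assumes "0 \<le> s"
  shows "continuous_on {s..T} (\<lambda>t. \<integral>\<omega>. v (X s \<omega>) * f (X t \<omega>) \<partial>M)"
  unfolding continuous_on_eq_continuous_within
  using markov_correlation_deriv[OF assms, of _ v f]
  by (meson DERIV_continuous continuous_within_subset atLeastAtMost_iff atLeast_iff subsetI)

text \<open>Dynkin's formula weighted by the observable \<open>v\<close> at the earlier time. Taking
  expectations throughout, it is just the fundamental theorem of calculus.\<close>

lemma markov_correlation_dynkin:
  fixes v f :: "'s \<Rightarrow> real"
  assumes "0 \<le> s" "s \<le> T"
  shows "((\<lambda>t. \<integral>\<omega>. v (X s \<omega>) * G f (X t \<omega>) \<partial>M) has_integral
    ((\<integral>\<omega>. v (X s \<omega>) * f (X T \<omega>) \<partial>M) - (\<integral>\<omega>. v (X s \<omega>) * f (X s \<omega>) \<partial>M))) {s..T}"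
proof (rule fundamental_theorem_of_calculus[OF assms(2)])
  fix t assume "t \<in> {s..T}"
  then have "((\<lambda>t. \<integral>\<omega>. v (X s \<omega>) * f (X t \<omega>) \<partial>M) has_real_derivative
      (\<integral>\<omega>. v (X s \<omega>) * G f (X t \<omega>) \<partial>M)) (at t within {s..T})"
    using markov_correlation_deriv[OF assms(1), of t v f] by (auto intro: DERIV_subset)
  then show "((\<lambda>t. \<integral>\<omega>. v (X s \<omega>) * f (X t \<omega>) \<partial>M) has_vector_derivative
      (\<integral>\<omega>. v (X s \<omega>) * G f (X t \<omega>) \<partial>M)) (at t within {s..T})"
    by (simp add: has_real_derivative_iff_has_vector_derivative)
qed

end

section \<open>The exclusion generator\<close>

text \<open>In the reservoir sums only \<open>jump_prob\<close> depends on \<open>y\<close>, so each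
  infinite sum collapses to a reservoir rate and finite sums over the bulk remain.\<close>

lemma generator_alt:
  "generator g \<theta> \<kappa> \<alpha> \<beta> N f \<eta> =
     1 / 2 * (\<Sum>x\<in>bulk N. \<Sum>y\<in>bulk N. jump_prob g (x - y) * (f (swap x y \<eta>) - f \<eta>))
     + \<kappa> / real N powr \<theta> * (\<Sum>x\<in>bulk N. reservoir_rate g x * (flip_rate x \<eta> \<alpha> * (f (flip x \<eta>) - f \<eta>)))
     + \<kappa> / real N powr \<theta> * (\<Sum>x\<in>bulk N. reservoir_rate g (int N - x) * (flip_rate x \<eta> \<beta> * (f (flip x \<eta>) - f \<eta>)))"
  unfolding generator_def reservoir_rate_right[symmetric]
  unfolding reservoir_rate_def mult.assoc infsum_cmult_left' ..

lemma configs_value: "\<eta> \<in> configs N \<Longrightarrow> x \<in> bulk N \<Longrightarrow> \<eta> x = 0 \<or> \<eta> x = 1"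
  by (auto simp: configs_def PiE_def Pi_def)

lemma swap_configs: "\<eta> \<in> configs N \<Longrightarrow> x \<in> bulk N \<Longrightarrow> y \<in> bulk N \<Longrightarrow> swap x y \<eta> \<in> configs N"
  by (auto simp: configs_def swap_def PiE_def Pi_def extensional_def)

lemma flip_configs: "\<eta> \<in> configs N \<Longrightarrow> x \<in> bulk N \<Longrightarrow> flip x \<eta> \<in> configs N"
  by (auto simp: configs_def flip_def PiE_def Pi_def extensional_def)

lemma generator_add:
  "generator g \<theta> \<kappa> \<alpha> \<beta> N (\<lambda>\<eta>. f \<eta> + h \<eta>) \<eta> = generator g \<theta> \<kappa> \<alpha> \<beta> N f \<eta> + generator g \<theta> \<kappa> \<alpha> \<beta> N h \<eta>"
proof -
  have *: "c * (d * (f a + h a - (f b + h b))) = c * (d * (f a - f b)) + c * (d * (h a - h b))"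
    "c * (f a + h a - (f b + h b)) = c * (f a - f b) + c * (h a - h b)" for c d a b
    by (simp_all add: algebra_simps)
  show ?thesis unfolding generator_alt * by (simp add: sum.distrib distrib_left add_divide_distrib)
qed

lemma generator_scale:
  "generator g \<theta> \<kappa> \<alpha> \<beta> N (\<lambda>\<eta>. c * f \<eta>) \<eta> = c * generator g \<theta> \<kappa> \<alpha> \<beta> N f \<eta>"
proof -
  have *: "d * (e * (c * f a - c * f b)) = c * (d * (e * (f a - f b)))"
    "d * (c * f a - c * f b) = c * (d * (f a - f b))" for d e a b
    by (simp_all add: algebra_simps)
  show ?thesis unfolding generator_alt * by (simp add: sum_distrib_left[symmetric] distrib_left mult.left_commute[of _ c])
qed

lemma flip_rate_le_1:
  assumes "0 < \<delta>" "\<delta> < 1" "\<eta> \<in> configs N" "x \<in> bulk N"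
  shows "\<bar>flip_rate x \<eta> \<delta>\<bar> \<le> 1"
  using configs_value[OF assms(3,4)] assms by (auto simp: flip_rate_def)

text \<open>A crude operator bound that depends on N. It serves the convergence of the exponential
  series, and no constant from it survives in the estimates.\<close>

lemma generator_bound:
  assumes ab: "0 < \<alpha>" "\<alpha> < 1" "0 < \<beta>" "\<beta> < 1"
    and f: "\<And>\<eta>. \<eta> \<in> configs N \<Longrightarrow> \<bar>f \<eta>\<bar> \<le> m" and \<eta>: "\<eta> \<in> configs N"
  shows "\<bar>generator g \<theta> \<kappa> \<alpha> \<beta> N f \<eta>\<bar> \<le>
    ((\<Sum>x\<in>bulk N. \<Sum>y\<in>bulk N. \<bar>jump_prob g (x - y)\<bar>)
     + 2 * \<bar>\<kappa> / real N powr \<theta>\<bar> * (\<Sum>x\<in>bulk N. \<bar>reservoir_rate g x\<bar>)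
     + 2 * \<bar>\<kappa> / real N powr \<theta>\<bar> * (\<Sum>x\<in>bulk N. \<bar>reservoir_rate g (int N - x)\<bar>)) * m"
proof -
  let ?q = "\<kappa> / real N powr \<theta>"
  have m: "0 \<le> m" using f[OF \<eta>] by linarith
  have d: "\<bar>f \<zeta> - f \<eta>\<bar> \<le> 2 * m" if "\<zeta> \<in> configs N" for \<zeta>
    using f[OF that] f[OF \<eta>] by linarith
  have "\<bar>\<Sum>x\<in>bulk N. \<Sum>y\<in>bulk N. jump_prob g (x - y) * (f (swap x y \<eta>) - f \<eta>)\<bar>
      \<le> (\<Sum>x\<in>bulk N. \<Sum>y\<in>bulk N. \<bar>jump_prob g (x - y)\<bar> * (2 * m))"
  proof (rule order_trans[OF sum_abs], rule sum_mono, rule order_trans[OF sum_abs], rule sum_mono)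
    fix x y assume "x \<in> bulk N" "y \<in> bulk N"
    then show "\<bar>jump_prob g (x - y) * (f (swap x y \<eta>) - f \<eta>)\<bar> \<le> \<bar>jump_prob g (x - y)\<bar> * (2 * m)"
      unfolding abs_mult using d[OF swap_configs[OF \<eta>]] by (intro mult_left_mono) auto
  qed
  also have "\<dots> = 2 * m * (\<Sum>x\<in>bulk N. \<Sum>y\<in>bulk N. \<bar>jump_prob g (x - y)\<bar>)"
    by (simp add: sum_distrib_left mult_ac)
  finally have 1: "\<bar>1 / 2 * (\<Sum>x\<in>bulk N. \<Sum>y\<in>bulk N. jump_prob g (x - y) * (f (swap x y \<eta>) - f \<eta>))\<bar>
      \<le> (\<Sum>x\<in>bulk N. \<Sum>y\<in>bulk N. \<bar>jump_prob g (x - y)\<bar>) * m"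
    by (simp add: mult.commute)
  have 2: "\<bar>?q * (\<Sum>x\<in>bulk N. r x * (flip_rate x \<eta> \<delta> * (f (flip x \<eta>) - f \<eta>)))\<bar>
      \<le> 2 * \<bar>?q\<bar> * (\<Sum>x\<in>bulk N. \<bar>r x\<bar>) * m" if \<delta>: "0 < \<delta>" "\<delta> < 1" for \<delta> and r :: "int \<Rightarrow> real"
  proof -
    have "\<bar>\<Sum>x\<in>bulk N. r x * (flip_rate x \<eta> \<delta> * (f (flip x \<eta>) - f \<eta>))\<bar> \<le> (\<Sum>x\<in>bulk N. \<bar>r x\<bar> * (1 * (2 * m)))"
    proof (rule order_trans[OF sum_abs], rule sum_mono)
      fix x assume x: "x \<in> bulk N"
      show "\<bar>r x * (flip_rate x \<eta> \<delta> * (f (flip x \<eta>) - f \<eta>))\<bar> \<le> \<bar>r x\<bar> * (1 * (2 * m))"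
        unfolding abs_mult using d[OF flip_configs[OF \<eta> x]] flip_rate_le_1[OF \<delta> \<eta> x]
        by (intro mult_left_mono mult_mono) auto
    qed
    then have "\<bar>?q\<bar> * \<bar>\<Sum>x\<in>bulk N. r x * (flip_rate x \<eta> \<delta> * (f (flip x \<eta>) - f \<eta>))\<bar>
        \<le> \<bar>?q\<bar> * (\<Sum>x\<in>bulk N. \<bar>r x\<bar> * (1 * (2 * m)))"
      by (rule mult_left_mono) simp
    also have "\<dots> = 2 * \<bar>?q\<bar> * (\<Sum>x\<in>bulk N. \<bar>r x\<bar>) * m"
      by (simp add: sum_distrib_left sum_distrib_right sum_divide_distrib mult_ac)
    finally show ?thesis unfolding abs_mult .
  qed
  have "\<bar>a + b + c\<bar> \<le> A + B + C" if "\<bar>a\<bar> \<le> A" "\<bar>b\<bar> \<le> B" "\<bar>c\<bar> \<le> C" for a b c A B C :: real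
    using that by linarith
  from this[OF 1 2[OF ab(1,2), of "reservoir_rate g"] 2[OF ab(3,4), of "\<lambda>x. reservoir_rate g (int N - x)"]]
  show ?thesis unfolding generator_alt distrib_right .
qed

lemma bounded_accelerated_generator:
  assumes "0 < \<alpha>" "\<alpha> < 1" "0 < \<beta>" "\<beta> < 1"
  obtains K where "bounded_generator (configs N) (accelerated_generator g \<theta> \<kappa> \<alpha> \<beta> N) K"
proof
  let ?K = "(\<Sum>x\<in>bulk N. \<Sum>y\<in>bulk N. \<bar>jump_prob g (x - y)\<bar>)
     + 2 * \<bar>\<kappa> / real N powr \<theta>\<bar> * (\<Sum>x\<in>bulk N. \<bar>reservoir_rate g x\<bar>)
     + 2 * \<bar>\<kappa> / real N powr \<theta>\<bar> * (\<Sum>x\<in>bulk N. \<bar>reservoir_rate g (int N - x)\<bar>)"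
  show "bounded_generator (configs N) (accelerated_generator g \<theta> \<kappa> \<alpha> \<beta> N) (real N powr g * ?K)"
  proof
    show "finite (configs N)" by (auto simp: configs_def bulk_def intro!: finite_PiE)
  next
    fix f :: "config \<Rightarrow> real" and m \<eta>
    assume "\<And>\<eta>. \<eta> \<in> configs N \<Longrightarrow> \<bar>f \<eta>\<bar> \<le> m" "\<eta> \<in> configs N"
    then have "\<bar>generator g \<theta> \<kappa> \<alpha> \<beta> N f \<eta>\<bar> \<le> ?K * m"
      by (rule generator_bound[OF assms])
    then show "\<bar>accelerated_generator g \<theta> \<kappa> \<alpha> \<beta> N f \<eta>\<bar> \<le> real N powr g * ?K * m"
      unfolding accelerated_generator_def abs_mult mult.assoc by (intro mult_mono) auto
  qed (simp_all add: fun_eq_iff accelerated_generator_def generator_add generator_scale distrib_left)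
qed

text \<open>At both values 0 and 1 the product is affine in the occupation: relaxation at unit rate
  to the reservoir density. This is one half of why the equations close.\<close>

lemma flip_rate_drift:
  assumes "\<eta> \<in> configs N" "y \<in> bulk N"
  shows "flip_rate y \<eta> \<delta> * (real (flip y \<eta> y) - real (\<eta> y)) = \<delta> - real (\<eta> y)"
  using configs_value[OF assms] by (auto simp: flip_rate_def flip_def)

text \<open>The other half: an exchange changes the value at \<open>y\<close> by a difference of
  occupation variables, without products, so the bulk part acts as the generator of a random walk.
  Each pair of sites is met in both orders, which compensates the factor 1/2.\<close>

lemma generator_occupation:
  assumes \<eta>: "\<eta> \<in> configs N" and y: "y \<in> bulk N"
  shows "generator g \<theta> \<kappa> \<alpha> \<beta> N (\<lambda>\<eta>. d - real (\<eta> y)) \<eta> =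
    (\<Sum>z\<in>bulk N. jump_prob g (y - z) * ((d - real (\<eta> z)) - (d - real (\<eta> y))))
    + \<kappa> / real N powr \<theta> * (reservoir_rate g y * (real (\<eta> y) - \<alpha>))
    + \<kappa> / real N powr \<theta> * (reservoir_rate g (int N - y) * (real (\<eta> y) - \<beta>))"
proof -
  have fin: "finite (bulk N)" by (simp add: bulk_def)
  let ?p = "\<lambda>x z. jump_prob g (x - z)"
  \<comment> \<open>For \<open>x = z = y\<close> both conditionals apply, harmlessly since
    \<open>jump_prob g 0 = 0\<close>.\<close>
  have "?p x z * ((d - real (swap x z \<eta> y)) - (d - real (\<eta> y))) =
      (if x = y then ?p y z * (real (\<eta> y) - real (\<eta> z)) else 0)
      + (if z = y then ?p y x * (real (\<eta> y) - real (\<eta> x)) else 0)" for x z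
    using jump_prob_commute[of g x y] by (cases "x = z") (auto simp: swap_def jump_prob_def)
  then have "(\<Sum>x\<in>bulk N. \<Sum>z\<in>bulk N. ?p x z * ((d - real (swap x z \<eta> y)) - (d - real (\<eta> y))))
      = (\<Sum>x\<in>bulk N. \<Sum>z\<in>bulk N. if x = y then ?p y z * (real (\<eta> y) - real (\<eta> z)) else 0)
      + (\<Sum>x\<in>bulk N. \<Sum>z\<in>bulk N. if z = y then ?p y x * (real (\<eta> y) - real (\<eta> x)) else 0)"
    by (simp only: sum.distrib)
  also have "(\<Sum>x\<in>bulk N. \<Sum>z\<in>bulk N. if x = y then ?p y z * (real (\<eta> y) - real (\<eta> z)) else 0)
      = (\<Sum>z\<in>bulk N. ?p y z * (real (\<eta> y) - real (\<eta> z)))"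
    by (subst sum.swap) (use fin y in simp)
  also have "(\<Sum>x\<in>bulk N. \<Sum>z\<in>bulk N. if z = y then ?p y x * (real (\<eta> y) - real (\<eta> x)) else 0)
      = (\<Sum>z\<in>bulk N. ?p y z * (real (\<eta> y) - real (\<eta> z)))"
    using fin y by simp
  finally have 1: "1 / 2 * (\<Sum>x\<in>bulk N. \<Sum>z\<in>bulk N. ?p x z * ((d - real (swap x z \<eta> y)) - (d - real (\<eta> y))))
      = (\<Sum>z\<in>bulk N. ?p y z * ((d - real (\<eta> z)) - (d - real (\<eta> y))))"
    by simp
  have 2: "(\<Sum>x\<in>bulk N. r x * (flip_rate x \<eta> \<delta> * ((d - real (flip x \<eta> y)) - (d - real (\<eta> y)))))
      = r y * (real (\<eta> y) - \<delta>)" for r \<delta>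
  proof -
    have "r x * (flip_rate x \<eta> \<delta> * ((d - real (flip x \<eta> y)) - (d - real (\<eta> y))))
      = (if x = y then r y * (real (\<eta> y) - \<delta>) else 0)" for x
    proof (cases "x = y")
      case True
      have "flip_rate y \<eta> \<delta> * ((d - real (flip y \<eta> y)) - (d - real (\<eta> y)))
        = - (flip_rate y \<eta> \<delta> * (real (flip y \<eta> y) - real (\<eta> y)))"
        by (simp add: algebra_simps)
      then show ?thesis unfolding flip_rate_drift[OF \<eta> y] using True by simp
    qed (simp add: flip_def)
    then show ?thesis using fin y by simp
  qed
  show ?thesis unfolding generator_alt 1 2 ..
qed

section \<open>Second moment of an additive functional\<close>

context
  fixes M :: "'w measure" and S :: "'s set" and G :: "('s \<Rightarrow> real) \<Rightarrow> 's \<Rightarrow> real" and K :: real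
    and \<mu> :: "'s measure" and X :: "real \<Rightarrow> 'w \<Rightarrow> 's" and V :: "'s \<Rightarrow> real" and T :: real
  assumes gen: "bounded_generator S G K" and markov: "markov_process M S G \<mu> X"
    and V_bound: "\<And>a. a \<in> S \<Longrightarrow> \<bar>V a\<bar> \<le> 1"
begin

interpretation prob_space M by (rule markov_prob_space[OF gen markov])

text \<open>The first point of the grid of mesh 1/(k+1) at or after \<open>t\<close> tends to
  \<open>t\<close> from the right, where the path is locally constant.\<close>

lemma markov_right_limit:
  assumes "\<omega> \<in> space M" "0 \<le> t"
  shows "(\<lambda>k. V (X (real (nat \<lceil>t * real (Suc k)\<rceil>) / real (Suc k)) \<omega>)) \<longlonglongrightarrow> V (X t \<omega>)"
proof -
  let ?\<tau> = "\<lambda>k. real (nat \<lceil>t * real (Suc k)\<rceil>) / real (Suc k)"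
  have ge: "t \<le> ?\<tau> k" for k
    using assms by (simp add: pos_le_divide_eq del: of_nat_Suc)
  have le: "?\<tau> k \<le> t + inverse (real (Suc k))" for k
  proof -
    have "real (nat \<lceil>t * real (Suc k)\<rceil>) \<le> t * real (Suc k) + 1"
      using assms by (simp del: of_nat_Suc)
    then have "?\<tau> k \<le> (t * real (Suc k) + 1) / real (Suc k)" by (rule divide_right_mono) simp
    then show ?thesis by (simp add: add_divide_distrib inverse_eq_divide del: of_nat_Suc)
  qed
  have "(\<lambda>k. t + inverse (real (Suc k))) \<longlonglongrightarrow> t + 0"
    by (intro tendsto_intros LIMSEQ_inverse_real_of_nat)
  then have upper: "(\<lambda>k. t + inverse (real (Suc k))) \<longlonglongrightarrow> t" by (simp only: add_0_right)
  have lim: "?\<tau> \<longlonglongrightarrow> t"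
    by (rule tendsto_sandwich[OF _ _ tendsto_const upper]) (blast intro: always_eventually ge le)+
  have "\<forall>\<^sub>F s in at_right t. X s \<omega> = X t \<omega>"
    using markov assms by (auto simp: markov_process_def)
  then obtain b where b: "t < b" "\<And>s. t < s \<Longrightarrow> s < b \<Longrightarrow> X s \<omega> = X t \<omega>"
    by (auto simp: eventually_at_right[of t "t + 1"])
  have "\<forall>\<^sub>F k in sequentially. ?\<tau> k < b"
    using order_tendstoD(2)[OF lim b(1)] .
  then have "\<forall>\<^sub>F k in sequentially. V (X (?\<tau> k) \<omega>) = V (X t \<omega>)"
  proof eventually_elim
    case (elim k)
    then show ?case using b(2)[of "?\<tau> k"] ge[of k] by (cases "?\<tau> k = t") auto
  qed
  then show ?thesis by (rule tendsto_eventually)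
qed

abbreviation (input) "time_measure \<equiv> restrict_space lborel {0..T}"

interpretation tm: finite_measure time_measure
  by (rule finite_measureI) (simp add: emeasure_restrict_space space_restrict_space emeasure_lborel_Icc_eq)

interpretation tM: pair_sigma_finite time_measure M ..

interpretation tt: pair_sigma_finite time_measure time_measure ..

lemma time_integral: "(\<integral>s. f s \<partial>time_measure) = (LBINT s:{0..T}. f s)" for f :: "real \<Rightarrow> real"
  by (simp add: integral_restrict_space set_lebesgue_integral_def)

text \<open>Each approximation reads the path at one of countably many fixed times, so it is jointly
  measurable, and the limit inherits this. The grid times may exceed \<open>T\<close>, where the
  process is still defined.\<close>

lemma markov_jointly_measurable:
  "(\<lambda>p. V (X (fst p) (snd p))) \<in> borel_measurable (time_measure \<Otimes>\<^sub>M M)"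
proof (rule borel_measurable_LIMSEQ_real)
  show "(\<lambda>k. V (X (real (nat \<lceil>fst p * real (Suc k)\<rceil>) / real (Suc k)) (snd p))) \<longlonglongrightarrow> V (X (fst p) (snd p))"
    if "p \<in> space (time_measure \<Otimes>\<^sub>M M)" for p
    using that by (intro markov_right_limit) (auto simp: space_pair_measure space_restrict_space)
  show "(\<lambda>p. V (X (real (nat \<lceil>fst p * real (Suc k)\<rceil>) / real (Suc k)) (snd p)))
      \<in> borel_measurable (time_measure \<Otimes>\<^sub>M M)" for k
  proof (rule measurable_compose_countable[where f = "\<lambda>i p. V (X (real i / real (Suc k)) (snd p))"])
    show "(\<lambda>p. V (X (real i / real (Suc k)) (snd p))) \<in> borel_measurable (time_measure \<Otimes>\<^sub>M M)" for i :: nat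
      by (rule measurable_compose[OF measurable_snd markov_observable_measurable[OF gen markov]]) simp
    have "(\<lambda>t. nat \<lceil>t * real (Suc k)\<rceil>) \<in> measurable borel (count_space UNIV)" by measurable
    then have "(\<lambda>t. nat \<lceil>t * real (Suc k)\<rceil>) \<in> measurable time_measure (count_space UNIV)"
      by (intro measurable_restrict_space1) simp
    then show "(\<lambda>p. nat \<lceil>fst p * real (Suc k)\<rceil>) \<in> measurable (time_measure \<Otimes>\<^sub>M M) (count_space UNIV)"
      by (rule measurable_compose[OF measurable_fst])
  qed
qed

lemma markov_observable_bound: "s \<in> space time_measure \<Longrightarrow> \<omega> \<in> space M \<Longrightarrow> \<bar>V (X s \<omega>)\<bar> \<le> 1"
  using markov_state[OF gen markov] by (intro V_bound) (auto simp: space_restrict_space)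

text \<open>The second moment is a double time integral of the correlation. By symmetry it is twice
  the integral over s \<le> t, the region where the Markov property gives information; hence the
  hypothesis bounds the integral over \<open>{s..T}\<close> for each fixed \<open>s\<close>.\<close>

lemma markov_second_moment:
  assumes T: "0 < T"
    and C: "\<And>s. 0 \<le> s \<Longrightarrow> s \<le> T \<Longrightarrow> \<bar>integral {s..T} (\<lambda>t. \<integral>\<omega>. V (X s \<omega>) * V (X t \<omega>) \<partial>M)\<bar> \<le> C"
  shows "(\<integral>\<^sup>+\<omega>. ennreal \<bar>LBINT s:{0..T}. V (X s \<omega>)\<bar> \<partial>M) \<le> ennreal (sqrt (2 * T * C))"
proof -
  define Z where "Z s \<omega> = V (X s \<omega>)" for s \<omega>
  define I where "I \<omega> = (\<integral>s. Z s \<omega> \<partial>time_measure)" for \<omega>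
  define k where "k s t = (\<integral>\<omega>. Z s \<omega> * Z t \<omega> \<partial>M)" for s t
  let ?tm = time_measure
  have Zb: "\<bar>Z s \<omega>\<bar> \<le> 1" if "s \<in> space ?tm" "\<omega> \<in> space M" for s \<omega>
    using markov_observable_bound[OF that] by (simp add: Z_def)
  have space_tm: "space ?tm = {0..T}" by (simp add: space_restrict_space)
  have Zm: "(\<lambda>p. Z (fst p) (snd p)) \<in> borel_measurable (?tm \<Otimes>\<^sub>M M)"
    using markov_jointly_measurable by (simp add: Z_def)
  have Zm1: "Z s \<in> borel_measurable M" if "s \<in> space ?tm" for s
    using measurable_compose[OF measurable_Pair1'[OF that] Zm] by simp
  have Zm2: "(\<lambda>s. Z s \<omega>) \<in> borel_measurable ?tm" if "\<omega> \<in> space M" for \<omega>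
    using measurable_compose[OF measurable_Pair2'[OF that] Zm] by simp
  have Im: "I \<in> borel_measurable M"
    unfolding I_def
    by (rule tm.borel_measurable_lebesgue_integral)
      (use measurable_compose[OF measurable_pair_swap' Zm] in \<open>simp add: case_prod_beta'\<close>)
  have mT: "measure ?tm (space ?tm) = T"
    using T by (simp add: measure_restrict_space space_restrict_space)
  have bounded_int: "\<bar>\<integral>s. f s \<partial>?tm\<bar> \<le> c * T" if "f \<in> borel_measurable ?tm" "\<And>s. s \<in> space ?tm \<Longrightarrow> \<bar>f s\<bar> \<le> c"
    for f c
  proof -
    have i: "integrable ?tm f" using that by (intro tm.integrable_const_bound[of _ c]) auto
    have "\<bar>\<integral>s. f s \<partial>?tm\<bar> \<le> (\<integral>s. \<bar>f s\<bar> \<partial>?tm)" by (rule integral_abs_bound)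
    also have "\<dots> \<le> (\<integral>s. c \<partial>?tm)" using i that by (intro integral_mono) auto
    finally show ?thesis using mT by (simp add: mult.commute)
  qed
  have Ib: "\<bar>I \<omega>\<bar> \<le> T" if "\<omega> \<in> space M" for \<omega>
    using bounded_int[of "\<lambda>s. Z s \<omega>" 1] Zm2[OF that] Zb[OF _ that] by (simp add: I_def)
  have Ii: "integrable M I" by (rule integrable_const_bound[of _ T]) (use Ib Im in auto)
  have prod_bound: "\<bar>a * b\<bar> \<le> c" if "\<bar>a\<bar> \<le> 1" "\<bar>b\<bar> \<le> c" for a b c :: real
    using mult_mono[OF that] by (simp add: abs_mult)
  have I2i: "integrable M (\<lambda>\<omega>. (I \<omega>)\<^sup>2)"
  proof (rule integrable_const_bound[of _ "T\<^sup>2"])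
    show "AE \<omega> in M. norm ((I \<omega>)\<^sup>2) \<le> T\<^sup>2"
      using power_mono[OF Ib, of _ 2] by (intro AE_I2) simp
  qed (use Im in measurable)
  have finM: "finite_measure (?tm \<Otimes>\<^sub>M M)" "finite_measure (?tm \<Otimes>\<^sub>M ?tm)"
    by (intro finite_measure_pair_measure tm.finite_measure_axioms finite_measure_axioms)+
  have kb: "\<bar>k s t\<bar> \<le> 1" if "s \<in> space ?tm" "t \<in> space ?tm" for s t
  proof -
    have b: "\<bar>Z s \<omega> * Z t \<omega>\<bar> \<le> 1" if "\<omega> \<in> space M" for \<omega>
      using Zb \<open>s \<in> space ?tm\<close> \<open>t \<in> space ?tm\<close> that by (intro prod_bound)
    have "integrable M (\<lambda>\<omega>. Z s \<omega> * Z t \<omega>)"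
      using b Zm1 that by (intro integrable_const_bound[of _ 1] AE_I2 borel_measurable_times) auto
    then have "(\<integral>\<omega>. \<bar>Z s \<omega> * Z t \<omega>\<bar> \<partial>M) \<le> (\<integral>\<omega>. 1 \<partial>M)"
      using b by (intro integral_mono integrable_abs) auto
    from order_trans[OF integral_abs_bound this] show ?thesis
      unfolding k_def by (simp add: prob_space)
  qed
  have km: "(\<lambda>p. k (fst p) (snd p)) \<in> borel_measurable (?tm \<Otimes>\<^sub>M ?tm)"
    unfolding k_def
  proof (rule borel_measurable_lebesgue_integral)
    have fst': "(\<lambda>q. (fst (fst q), snd q)) \<in> measurable ((?tm \<Otimes>\<^sub>M ?tm) \<Otimes>\<^sub>M M) (?tm \<Otimes>\<^sub>M M)"
      by (intro measurable_Pair measurable_compose[OF measurable_fst measurable_fst] measurable_snd)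
    have snd': "(\<lambda>q. (snd (fst q), snd q)) \<in> measurable ((?tm \<Otimes>\<^sub>M ?tm) \<Otimes>\<^sub>M M) (?tm \<Otimes>\<^sub>M M)"
      by (intro measurable_Pair measurable_compose[OF measurable_fst measurable_snd] measurable_snd)
    from borel_measurable_times[OF measurable_compose[OF fst' Zm] measurable_compose[OF snd' Zm]]
    show "(\<lambda>(p, \<omega>). Z (fst p) \<omega> * Z (snd p) \<omega>) \<in> borel_measurable ((?tm \<Otimes>\<^sub>M ?tm) \<Otimes>\<^sub>M M)"
      by (simp add: case_prod_beta')
  qed
  \<comment> \<open>The diagonal is given to \<open>up\<close>; off this null set
    \<open>down\<close> is the mirror image of \<open>up\<close>.\<close>
  define up where "up p = (if fst p \<le> snd p then k (fst p) (snd p) else 0)" for p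
  define down where "down p = (if fst p \<le> snd p then 0 else k (fst p) (snd p))" for p
  have up_down: "up p + down p = k (fst p) (snd p)" for p by (simp add: up_def down_def)
  have "(\<lambda>x. x) \<in> borel_measurable ?tm" by (intro measurable_restrict_space1) simp
  then have fs: "fst \<in> borel_measurable (?tm \<Otimes>\<^sub>M ?tm)" "snd \<in> borel_measurable (?tm \<Otimes>\<^sub>M ?tm)"
    by (auto intro: measurable_compose[OF measurable_fst] measurable_compose[OF measurable_snd])
  have le: "{p \<in> space (?tm \<Otimes>\<^sub>M ?tm). fst p \<le> snd p} \<in> sets (?tm \<Otimes>\<^sub>M ?tm)"
    by (rule borel_measurable_le[OF fs])
  have kb2: "\<bar>k (fst p) (snd p)\<bar> \<le> 1" if "p \<in> space (?tm \<Otimes>\<^sub>M ?tm)" for p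
    using that by (intro kb) (auto simp: space_pair_measure)
  have k_int: "integrable (?tm \<Otimes>\<^sub>M ?tm) (\<lambda>p. k (fst p) (snd p))"
    by (rule finite_measure.integrable_const_bound[OF finM(2) AE_I2 km, of 1]) (simp add: kb2)
  have up_int: "integrable (?tm \<Otimes>\<^sub>M ?tm) up"
  proof (rule finite_measure.integrable_const_bound[OF finM(2), of _ 1])
    show "up \<in> borel_measurable (?tm \<Otimes>\<^sub>M ?tm)"
      unfolding up_def by (rule measurable_If[OF km _ le]) simp
    show "AE p in ?tm \<Otimes>\<^sub>M ?tm. norm (up p) \<le> 1"
      using kb2 by (intro AE_I2) (simp add: up_def)
  qed
  have down_int: "integrable (?tm \<Otimes>\<^sub>M ?tm) down"
  proof (rule finite_measure.integrable_const_bound[OF finM(2), of _ 1])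
    show "down \<in> borel_measurable (?tm \<Otimes>\<^sub>M ?tm)"
      unfolding down_def by (rule measurable_If[OF _ km le]) simp
    show "AE p in ?tm \<Otimes>\<^sub>M ?tm. norm (down p) \<le> 1"
      using kb2 by (intro AE_I2) (simp add: down_def)
  qed
  have ksym: "k s t = k t s" for s t by (simp add: k_def mult.commute)
  have "(\<integral>\<omega>. (I \<omega>)\<^sup>2 \<partial>M) = (\<integral>\<omega>. (\<integral>s. Z s \<omega> * I \<omega> \<partial>?tm) \<partial>M)"
    by (simp add: power2_eq_square I_def)
  also have "\<dots> = (\<integral>s. (\<integral>\<omega>. Z s \<omega> * I \<omega> \<partial>M) \<partial>?tm)"
  proof (rule tM.Fubini_integral, rule finite_measure.integrable_const_bound[OF finM(1), of _ T])
    show "(\<lambda>(s, \<omega>). Z s \<omega> * I \<omega>) \<in> borel_measurable (?tm \<Otimes>\<^sub>M M)"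
      using borel_measurable_times[OF Zm measurable_compose[OF measurable_snd Im]] by (simp add: case_prod_beta')
    show "AE p in ?tm \<Otimes>\<^sub>M M. norm (case p of (s, \<omega>) \<Rightarrow> Z s \<omega> * I \<omega>) \<le> T"
    proof (rule AE_I2)
      fix p assume "p \<in> space (?tm \<Otimes>\<^sub>M M)"
      then have "fst p \<in> space ?tm" "snd p \<in> space M" by (auto simp: space_pair_measure)
      from prod_bound[OF Zb[OF this] Ib[OF this(2)]]
      show "norm (case p of (s, \<omega>) \<Rightarrow> Z s \<omega> * I \<omega>) \<le> T" by (simp add: split_beta)
    qed
  qed
  also have "\<dots> = (\<integral>s. (\<integral>t. k s t \<partial>?tm) \<partial>?tm)"
  proof (rule Bochner_Integration.integral_cong[OF refl])
    fix s assume s: "s \<in> space ?tm"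
    have "(\<integral>\<omega>. Z s \<omega> * I \<omega> \<partial>M) = (\<integral>\<omega>. (\<integral>t. Z s \<omega> * Z t \<omega> \<partial>?tm) \<partial>M)"
      by (simp add: I_def)
    also have "\<dots> = (\<integral>t. (\<integral>\<omega>. Z s \<omega> * Z t \<omega> \<partial>M) \<partial>?tm)"
    proof (rule tM.Fubini_integral, rule finite_measure.integrable_const_bound[OF finM(1), of _ 1])
      show "(\<lambda>(t, \<omega>). Z s \<omega> * Z t \<omega>) \<in> borel_measurable (?tm \<Otimes>\<^sub>M M)"
        using borel_measurable_times[OF measurable_compose[OF measurable_snd Zm1[OF s]] Zm]
        by (simp add: case_prod_beta')
      show "AE p in ?tm \<Otimes>\<^sub>M M. norm (case p of (t, \<omega>) \<Rightarrow> Z s \<omega> * Z t \<omega>) \<le> 1"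
      proof (rule AE_I2)
        fix p assume "p \<in> space (?tm \<Otimes>\<^sub>M M)"
        then have "fst p \<in> space ?tm" "snd p \<in> space M" by (auto simp: space_pair_measure)
        from prod_bound[OF Zb[OF s this(2)] Zb[OF this]]
        show "norm (case p of (t, \<omega>) \<Rightarrow> Z s \<omega> * Z t \<omega>) \<le> 1" by (simp add: split_beta)
      qed
    qed
    finally show "(\<integral>\<omega>. Z s \<omega> * I \<omega> \<partial>M) = (\<integral>t. k s t \<partial>?tm)" by (simp add: k_def)
  qed
  also have "\<dots> = (\<integral>p. k (fst p) (snd p) \<partial>(?tm \<Otimes>\<^sub>M ?tm))"
    using tt.integral_fst'[OF k_int] by (simp only: fst_conv snd_conv)
  also have "\<dots> = (\<integral>p. up p + down p \<partial>(?tm \<Otimes>\<^sub>M ?tm))"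
    by (simp add: up_down)
  also have "\<dots> = (\<integral>p. up p \<partial>(?tm \<Otimes>\<^sub>M ?tm)) + (\<integral>p. down p \<partial>(?tm \<Otimes>\<^sub>M ?tm))"
    by (intro Bochner_Integration.integral_add up_int down_int)
  also have "(\<integral>p. up p \<partial>(?tm \<Otimes>\<^sub>M ?tm)) = (\<integral>s. (\<integral>t. up (s, t) \<partial>?tm) \<partial>?tm)"
    by (rule tt.integral_fst'[OF up_int, symmetric])
  also have "(\<integral>p. down p \<partial>(?tm \<Otimes>\<^sub>M ?tm)) = (\<integral>t. (\<integral>s. down (s, t) \<partial>?tm) \<partial>?tm)"
    by (rule tt.integral_snd[of "\<lambda>s t. down (s, t)", unfolded case_prod_eta, OF down_int, symmetric])
  also have "\<dots> = (\<integral>s. (\<integral>t. up (s, t) \<partial>?tm) \<partial>?tm)"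
  proof (rule Bochner_Integration.integral_cong[OF refl])
    fix t assume t: "t \<in> space ?tm"
    have "AE s in ?tm. s \<noteq> t"
    proof (subst AE_restrict_space_iff)
      show "AE s in lborel. s \<in> {0..T} \<longrightarrow> s \<noteq> t"
        using AE_lborel_singleton[of t] by eventually_elim simp
    qed simp
    then have ae: "AE s in ?tm. down (s, t) = up (t, s)"
    proof eventually_elim
      case (elim s)
      then show ?case using ksym[of s t] by (simp add: up_def down_def)
    qed
    show "(\<integral>s. down (s, t) \<partial>?tm) = (\<integral>s. up (t, s) \<partial>?tm)"
      by (rule integral_cong_AE[OF _ _ ae])
        (rule measurable_compose[OF measurable_Pair2'[OF t] borel_measurable_integrable[OF down_int]]
          measurable_compose[OF measurable_Pair1'[OF t] borel_measurable_integrable[OF up_int]])+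
  qed
  also have "\<bar>(\<integral>s. (\<integral>t. up (s, t) \<partial>?tm) \<partial>?tm) + (\<integral>s. (\<integral>t. up (s, t) \<partial>?tm) \<partial>?tm)\<bar> \<le> 2 * T * C"
  proof -
    have "\<bar>\<integral>s. (\<integral>t. up (s, t) \<partial>?tm) \<partial>?tm\<bar> \<le> C * T"
    proof (rule bounded_int)
      show "(\<lambda>s. \<integral>t. up (s, t) \<partial>?tm) \<in> borel_measurable ?tm"
        by (rule tm.borel_measurable_lebesgue_integral)
          (use borel_measurable_integrable[OF up_int] in \<open>simp only: case_prod_eta\<close>)
      fix s assume "s \<in> space ?tm"
      then have s: "0 \<le> s" "s \<le> T" by (auto simp: space_tm)
      have "(\<integral>t. up (s, t) \<partial>?tm) = (\<integral>t. indicator {0..T} t *\<^sub>R up (s, t) \<partial>lborel)"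
        by (rule integral_restrict_space) simp
      also have "\<dots> = (LBINT t:{s..T}. k s t)"
        unfolding set_lebesgue_integral_def
        by (rule Bochner_Integration.integral_cong) (use s in \<open>auto simp: up_def indicator_def\<close>)
      \<comment> \<open>Continuity in \<open>t\<close> identifies the Lebesgue integral with the
        Henstock-Kurzweil integral in which \<open>C\<close> is stated.\<close>
      also have "\<dots> = integral {s..T} (\<lambda>t. \<integral>\<omega>. V (X s \<omega>) * V (X t \<omega>) \<partial>M)"
        unfolding k_def Z_def
        by (intro set_borel_integral_eq_integral(2) borel_integrable_atLeastAtMost'
            markov_correlation_continuous[OF gen markov] s)
      finally show "\<bar>\<integral>t. up (s, t) \<partial>?tm\<bar> \<le> C"
        using C[OF s] by simp
    qed
    moreover have "\<bar>a + a\<bar> \<le> 2 * T * C" if "\<bar>a\<bar> \<le> C * T" for a :: real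
      using that by (simp add: abs_le_iff mult.commute)
    ultimately show ?thesis by blast
  qed
  finally have "\<bar>\<integral>\<omega>. (I \<omega>)\<^sup>2 \<partial>M\<bar> \<le> 2 * T * C" .
  then have I2: "(\<integral>\<omega>. (I \<omega>)\<^sup>2 \<partial>M) \<le> 2 * T * C" by simp
  \<comment> \<open>Nonnegativity of the variance plays the part of Cauchy-Schwarz: E|I| \<le> sqrt
    (E[I^2]).\<close>
  have "0 \<le> variance (\<lambda>\<omega>. \<bar>I \<omega>\<bar>)" by (rule variance_positive)
  also have "\<dots> = (\<integral>\<omega>. \<bar>I \<omega>\<bar>\<^sup>2 \<partial>M) - (\<integral>\<omega>. \<bar>I \<omega>\<bar> \<partial>M)\<^sup>2"
    by (rule variance_eq) (use Ii I2i in auto)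
  finally have "(\<integral>\<omega>. \<bar>I \<omega>\<bar> \<partial>M) \<le> sqrt (2 * T * C)"
    using I2 by (intro real_le_rsqrt) simp
  moreover have "(\<integral>\<^sup>+\<omega>. ennreal \<bar>I \<omega>\<bar> \<partial>M) = ennreal (\<integral>\<omega>. \<bar>I \<omega>\<bar> \<partial>M)"
    by (rule nn_integral_eq_integral) (use Ii in auto)
  ultimately show ?thesis
    unfolding I_def Z_def time_integral using ennreal_leI by metis
qed

end

section \<open>Replacement at the boundary\<close>

lemma markov_correlation_bound:
  fixes v f :: "'s \<Rightarrow> real"
  assumes gen: "bounded_generator S G K" and markov: "markov_process M S G \<mu> X"
    and st: "0 \<le> s" "0 \<le> t" and v: "\<And>a. a \<in> S \<Longrightarrow> \<bar>v a\<bar> \<le> 1" and f: "\<And>a. a \<in> S \<Longrightarrow> \<bar>f a\<bar> \<le> 1"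
  shows "\<bar>\<integral>\<omega>. v (X s \<omega>) * f (X t \<omega>) \<partial>M\<bar> \<le> 1"
proof -
  interpret prob_space M by (rule markov_prob_space[OF gen markov])
  have "\<bar>v (X s \<omega>) * f (X t \<omega>)\<bar> \<le> 1" if "\<omega> \<in> space M" for \<omega>
    using mult_mono[OF v f, of "X s \<omega>" "X t \<omega>"] markov_state[OF gen markov] st that by (simp add: abs_mult)
  then have "(\<integral>\<omega>. \<bar>v (X s \<omega>) * f (X t \<omega>)\<bar> \<partial>M) \<le> (\<integral>\<omega>. 1 \<partial>M)"
    by (intro integral_mono integrable_abs markov_observable_product_integrable[OF gen markov] st) auto
  from order_trans[OF integral_abs_bound this] show ?thesis by (simp add: prob_space)
qed

section \<open>The integrated profile of the exclusion process and its elliptic equation\<close>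

locale exclusion_process =
  fixes \<gamma> \<theta> \<kappa> \<alpha> \<beta> T :: real and N :: nat
    and M :: "'w measure" and \<mu> :: "config measure" and X :: "real \<Rightarrow> 'w \<Rightarrow> config"
  assumes \<gamma>: "1 < \<gamma>" "\<gamma> < 2" and \<theta>: "0 \<le> \<theta>" and \<kappa>: "0 < \<kappa>"
    and \<alpha>: "0 < \<alpha>" "\<alpha> < 1" and \<beta>: "0 < \<beta>" "\<beta> < 1" and T: "0 < T" and N: "2 \<le> N"
    and process: "markov_process M (configs N) (accelerated_generator \<gamma> \<theta> \<kappa> \<alpha> \<beta> N) \<mu> X"
begin

text \<open>U_t(y) of the overview for an arbitrary observable \<open>V\<close> and level \<delta>;
  \<alpha> will be used on the left and \<beta> on the right.\<close>

definition covar :: "(config \<Rightarrow> real) \<Rightarrow> real \<Rightarrow> real \<Rightarrow> real \<Rightarrow> int \<Rightarrow> real" where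
  "covar V \<delta> s t y = (\<integral>\<omega>. V (X s \<omega>) * (\<delta> - real (X t \<omega> y)) \<partial>M)"

definition profile :: "(config \<Rightarrow> real) \<Rightarrow> real \<Rightarrow> real \<Rightarrow> int \<Rightarrow> real" where
  "profile V \<delta> s y = integral {s..T} (\<lambda>t. covar V \<delta> s t y)"

lemma covar_integrable:
  assumes "0 \<le> s" "0 \<le> t"
  shows "integrable M (\<lambda>\<omega>. V (X s \<omega>) * (\<delta> - real (X t \<omega> y)))"
proof -
  obtain K where gen: "bounded_generator (configs N) (accelerated_generator \<gamma> \<theta> \<kappa> \<alpha> \<beta> N) K"
    using bounded_accelerated_generator[OF \<alpha> \<beta>] .
  from markov_observable_product_integrable[OF gen process assms] show ?thesis .
qed

lemma covar_continuous:
  assumes "0 \<le> s"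
  shows "continuous_on {s..T} (\<lambda>t. covar V \<delta> s t y)"
proof -
  obtain K where gen: "bounded_generator (configs N) (accelerated_generator \<gamma> \<theta> \<kappa> \<alpha> \<beta> N) K"
    using bounded_accelerated_generator[OF \<alpha> \<beta>] .
  from markov_correlation_continuous[OF gen process assms] show ?thesis unfolding covar_def .
qed

lemma covar_bound:
  assumes "0 \<le> s" "0 \<le> t" "y \<in> bulk N" "\<And>\<eta>. \<eta> \<in> configs N \<Longrightarrow> \<bar>V \<eta>\<bar> \<le> 1" "0 < \<delta>" "\<delta> < 1"
  shows "\<bar>covar V \<delta> s t y\<bar> \<le> 1"
proof -
  obtain K where gen: "bounded_generator (configs N) (accelerated_generator \<gamma> \<theta> \<kappa> \<alpha> \<beta> N) K"
    using bounded_accelerated_generator[OF \<alpha> \<beta>] .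
  have "\<bar>\<delta> - real (\<eta> y)\<bar> \<le> 1" if "\<eta> \<in> configs N" for \<eta>
    using configs_value[OF that assms(3)] assms(5,6) by auto
  with assms(4) show ?thesis
    unfolding covar_def by (intro markov_correlation_bound[OF gen process assms(1,2)])
qed

lemma profile_bound:
  assumes "0 \<le> s" "s \<le> T" "y \<in> bulk N" "\<And>\<eta>. \<eta> \<in> configs N \<Longrightarrow> \<bar>V \<eta>\<bar> \<le> 1" "0 < \<delta>" "\<delta> < 1"
  shows "\<bar>profile V \<delta> s y\<bar> \<le> T"
proof -
  have "norm (profile V \<delta> s y) \<le> 1 * (T - s)"
    unfolding profile_def
    by (rule integral_bound[OF assms(2) covar_continuous[OF assms(1)]])
      (use covar_bound[OF assms(1) _ assms(3,4,5,6)] assms(1) in auto)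
  then show ?thesis using assms(1) by simp
qed

text \<open>Dynkin's formula for \<delta> - \<eta>(y). Writing \<eta>(y) - \<alpha> as (\<delta> -
  \<alpha>) - (\<delta> - \<eta>(y)), and likewise for \<beta>, splits each reservoir term into a
  source and a killing; \<delta> = \<alpha> or \<delta> = \<beta> removes the source of that
  reservoir.\<close>

lemma profile_balance:
  assumes s: "0 \<le> s" "s \<le> T" and y: "y \<in> bulk N"
  shows "real N powr \<gamma> * ((\<Sum>z\<in>bulk N. jump_prob \<gamma> (y - z) * (profile V \<delta> s z - profile V \<delta> s y))
      + \<kappa> / real N powr \<theta> * (reservoir_rate \<gamma> y *
          ((\<delta> - \<alpha>) * ((T - s) * (\<integral>\<omega>. V (X s \<omega>) \<partial>M)) - profile V \<delta> s y))
      + \<kappa> / real N powr \<theta> * (reservoir_rate \<gamma> (int N - y) *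
          ((\<delta> - \<beta>) * ((T - s) * (\<integral>\<omega>. V (X s \<omega>) \<partial>M)) - profile V \<delta> s y)))
    = covar V \<delta> s T y - covar V \<delta> s s y"
proof -
  let ?G = "accelerated_generator \<gamma> \<theta> \<kappa> \<alpha> \<beta> N" and ?f = "\<lambda>\<eta>::config. \<delta> - real (\<eta> y)"
  obtain K where gen: "bounded_generator (configs N) ?G K"
    using bounded_accelerated_generator[OF \<alpha> \<beta>] .
  define q where "q = \<kappa> / real N powr \<theta>"
  define v where "v = (\<integral>\<omega>. V (X s \<omega>) \<partial>M)"
  define A where "A = real N powr \<gamma>"
  let ?r = "reservoir_rate \<gamma>"
  \<comment> \<open>Jointly linear in the source \<open>w\<close> and the profile \<open>u\<close>,
    so the same expression passes through the multiplication by \<open>V\<close>, the expectation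
    and the time integral.\<close>
  let ?rhs = "\<lambda>w u. A * ((\<Sum>z\<in>bulk N. jump_prob \<gamma> (y - z) * (u z - u y))
      + q * (?r y * ((\<delta> - \<alpha>) * w - u y)) + q * (?r (int N - y) * ((\<delta> - \<beta>) * w - u y)))"
  have Vi: "integrable M (\<lambda>\<omega>. V (X s \<omega>))"
    using markov_observable_product_integrable[OF gen process s(1) s(1), of V "\<lambda>_. 1"] by simp
  have drift: "(\<integral>\<omega>. V (X s \<omega>) * ?G ?f (X t \<omega>) \<partial>M) = ?rhs v (covar V \<delta> s t)" if t: "0 \<le> t" for t
  proof -
    note ci = covar_integrable[OF s(1) t, of V \<delta>]
    have "(\<integral>\<omega>. V (X s \<omega>) * ?G ?f (X t \<omega>) \<partial>M)
      = (\<integral>\<omega>. ?rhs (V (X s \<omega>)) (\<lambda>z. V (X s \<omega>) * (\<delta> - real (X t \<omega> z))) \<partial>M)"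
    proof (rule Bochner_Integration.integral_cong[OF refl])
      fix \<omega> assume "\<omega> \<in> space M"
      then have "X t \<omega> \<in> configs N" using markov_state[OF gen process t] by simp
      then have G: "?G ?f (X t \<omega>) = ?rhs 1 (\<lambda>z. \<delta> - real (X t \<omega> z))"
        unfolding accelerated_generator_def A_def q_def
        by (simp add: generator_occupation[OF _ y])
      show "V (X s \<omega>) * ?G ?f (X t \<omega>) = ?rhs (V (X s \<omega>)) (\<lambda>z. V (X s \<omega>) * (\<delta> - real (X t \<omega> z)))"
        unfolding G by (simp add: sum_distrib_left algebra_simps)
    qed
    also have "\<dots> = ?rhs v (covar V \<delta> s t)"
      unfolding v_def covar_def using Vi ci by simp
    finally show ?thesis .
  qed
  have W: "((\<lambda>t. covar V \<delta> s t z) has_integral profile V \<delta> s z) {s..T}" for z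
    unfolding profile_def by (intro integrable_integral integrable_continuous_real covar_continuous s)
  have v: "((\<lambda>t. v) has_integral (T - s) * v) {s..T}"
    using has_integral_const_real[of v s T] s by simp
  have fin: "finite (bulk N)" by (simp add: bulk_def)
  have "((\<lambda>t. ?rhs v (covar V \<delta> s t)) has_integral ?rhs ((T - s) * v) (profile V \<delta> s)) {s..T}"
    by (intro has_integral_mult_right has_integral_add has_integral_diff has_integral_sum fin W v)
  moreover have "((\<lambda>t. ?rhs v (covar V \<delta> s t)) has_integral (covar V \<delta> s T y - covar V \<delta> s s y)) {s..T}"
    using markov_correlation_dynkin[OF gen process s, of V ?f] unfolding covar_def[symmetric]
    by (rule has_integral_eq[rotated]) (use drift s in auto)
  ultimately show ?thesis
    unfolding A_def q_def v_def by (rule has_integral_unique)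
qed

lemma profile_source_bound:
  assumes "0 \<le> s" "s \<le> T" "\<And>\<eta>. \<eta> \<in> configs N \<Longrightarrow> \<bar>V \<eta>\<bar> \<le> 1" "\<bar>d\<bar> \<le> 1"
  shows "\<bar>d * ((T - s) * (\<integral>\<omega>. V (X s \<omega>) \<partial>M))\<bar> \<le> T"
proof -
  obtain K where gen: "bounded_generator (configs N) (accelerated_generator \<gamma> \<theta> \<kappa> \<alpha> \<beta> N) K"
    using bounded_accelerated_generator[OF \<alpha> \<beta>] .
  have "\<bar>\<integral>\<omega>. V (X s \<omega>) \<partial>M\<bar> \<le> 1"
    using markov_correlation_bound[OF gen process assms(1) assms(1), of V "\<lambda>_. 1"] assms(3) by simp
  then have "\<bar>d\<bar> * ((T - s) * \<bar>\<integral>\<omega>. V (X s \<omega>) \<partial>M\<bar>) \<le> 1 * (T * 1)"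
    using assms by (intro mult_mono mult_nonneg_nonneg) auto
  then show ?thesis using assms(2) by (simp add: abs_mult)
qed

lemma scaled_increment_bound:
  assumes "0 \<le> s" "s \<le> T" "y \<in> bulk N" "\<And>\<eta>. \<eta> \<in> configs N \<Longrightarrow> \<bar>V \<eta>\<bar> \<le> 1" "0 < \<delta>" "\<delta> < 1"
  shows "\<bar>(covar V \<delta> s T y - covar V \<delta> s s y) * real N powr - \<gamma>\<bar> \<le> 2 * real N powr - \<gamma>"
proof -
  have "\<bar>covar V \<delta> s T y - covar V \<delta> s s y\<bar> \<le> 2"
    using covar_bound[where V = V, OF assms(1) _ assms(3-6), of T] covar_bound[where V = V, OF assms(1,1) assms(3-6)]
      assms(1,2) by linarith
  then show ?thesis unfolding abs_mult by (intro mult_mono) auto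
qed

lemma powr_cancel: "real N powr \<gamma> * a = c \<Longrightarrow> a = c * real N powr - \<gamma>"
  using N by (auto simp: powr_minus_divide)

text \<open>With \<delta> = \<alpha> only the right source is left, and its strength is the
  \<open>b\<close> supplied here.\<close>

lemma left_profile_mean:
  assumes s: "0 \<le> s" "s \<le> T" and V: "\<And>\<eta>. \<eta> \<in> configs N \<Longrightarrow> \<bar>V \<eta>\<bar> \<le> 1" and n: "1 \<le> n" "n < N"
  shows "\<bar>block_mean (profile V \<alpha> s) n\<bar> \<le> block_bound \<gamma> \<theta> \<kappa> T N (real n)"
proof (rule block_mean_le_block_bound[OF \<gamma> N \<theta> \<kappa> _ _ _ _ n,
      where b = "(\<alpha> - \<beta>) * ((T - s) * (\<integral>\<omega>. V (X s \<omega>) \<partial>M))"])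
  show "\<bar>(\<alpha> - \<beta>) * ((T - s) * (\<integral>\<omega>. V (X s \<omega>) \<partial>M))\<bar> \<le> T"
    using profile_source_bound[where V = V, OF s V] \<alpha> \<beta> by auto
  fix y assume y: "y \<in> bulk N"
  show "\<bar>profile V \<alpha> s y\<bar> \<le> T" by (rule profile_bound[where V = V, OF s y V \<alpha>])
  show "\<bar>(covar V \<alpha> s T y - covar V \<alpha> s s y) * real N powr - \<gamma>\<bar> \<le> 2 * real N powr - \<gamma>"
    by (rule scaled_increment_bound[where V = V, OF s y V \<alpha>])
  show "(\<Sum>z\<in>bulk N. jump_prob \<gamma> (y - z) * (profile V \<alpha> s z - profile V \<alpha> s y))
      - \<kappa> / real N powr \<theta> * (reservoir_rate \<gamma> y + reservoir_rate \<gamma> (int N - y)) * profile V \<alpha> s y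
      + \<kappa> / real N powr \<theta> * ((\<alpha> - \<beta>) * ((T - s) * (\<integral>\<omega>. V (X s \<omega>) \<partial>M))) * reservoir_rate \<gamma> (int N - y)
      = (covar V \<alpha> s T y - covar V \<alpha> s s y) * real N powr - \<gamma>"
    unfolding powr_cancel[OF profile_balance[OF s y, of V \<alpha>], symmetric]
    by (simp add: algebra_simps)
qed

lemma right_profile_mean:
  assumes s: "0 \<le> s" "s \<le> T" and V: "\<And>\<eta>. \<eta> \<in> configs N \<Longrightarrow> \<bar>V \<eta>\<bar> \<le> 1" and n: "1 \<le> n" "n < N"
  shows "\<bar>block_mean (\<lambda>x. profile V \<beta> s (int N - x)) n\<bar> \<le> block_bound \<gamma> \<theta> \<kappa> T N (real n)"
proof (rule block_mean_le_block_bound[OF \<gamma> N \<theta> \<kappa> _ _ _ _ n,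
      where b = "(\<beta> - \<alpha>) * ((T - s) * (\<integral>\<omega>. V (X s \<omega>) \<partial>M))"])
  show "\<bar>(\<beta> - \<alpha>) * ((T - s) * (\<integral>\<omega>. V (X s \<omega>) \<partial>M))\<bar> \<le> T"
    using profile_source_bound[where V = V, OF s V] \<alpha> \<beta> by auto
  fix x assume x: "x \<in> bulk N"
  then have y: "int N - x \<in> bulk N" by (auto simp: bulk_def)
  show "\<bar>profile V \<beta> s (int N - x)\<bar> \<le> T" by (rule profile_bound[where V = V, OF s y V \<beta>])
  show "\<bar>(covar V \<beta> s T (int N - x) - covar V \<beta> s s (int N - x)) * real N powr - \<gamma>\<bar> \<le> 2 * real N powr - \<gamma>"
    by (rule scaled_increment_bound[where V = V, OF s y V \<beta>])
  \<comment> \<open>The bulk operator commutes with x -> N - x because the jump law is symmetric,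
    while the two reservoir rates trade places.\<close>
  have reflect: "(\<Sum>z\<in>bulk N. jump_prob \<gamma> (x - z) * (profile V \<beta> s (int N - z) - profile V \<beta> s (int N - x)))
    = (\<Sum>z\<in>bulk N. jump_prob \<gamma> (int N - x - z) * (profile V \<beta> s z - profile V \<beta> s (int N - x)))"
  proof (rule sum.reindex_bij_witness[of _ "\<lambda>z. int N - z" "\<lambda>z. int N - z"])
    fix z
    have "jump_prob \<gamma> (int N - x - (int N - z)) = jump_prob \<gamma> (x - z)"
      using jump_prob_commute[of \<gamma> z x] by simp
    then show "jump_prob \<gamma> (int N - x - (int N - z)) * (profile V \<beta> s (int N - z) - profile V \<beta> s (int N - x))
      = jump_prob \<gamma> (x - z) * (profile V \<beta> s (int N - z) - profile V \<beta> s (int N - x))"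
      by simp
  qed (auto simp: bulk_def)
  show "(\<Sum>z\<in>bulk N. jump_prob \<gamma> (x - z) * (profile V \<beta> s (int N - z) - profile V \<beta> s (int N - x)))
      - \<kappa> / real N powr \<theta> * (reservoir_rate \<gamma> x + reservoir_rate \<gamma> (int N - x)) * profile V \<beta> s (int N - x)
      + \<kappa> / real N powr \<theta> * ((\<beta> - \<alpha>) * ((T - s) * (\<integral>\<omega>. V (X s \<omega>) \<partial>M))) * reservoir_rate \<gamma> (int N - x)
      = (covar V \<beta> s T (int N - x) - covar V \<beta> s s (int N - x)) * real N powr - \<gamma>"
    unfolding powr_cancel[OF profile_balance[OF s y, of V \<beta>], symmetric] reflect
    by (simp add: algebra_simps)
qed

text \<open>Here \<open>V\<close> becomes the window average itself, so its autocorrelation is the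
  block mean of the profile. The map \<open>p\<close> is the identity on the left and x -> N - x on
  the right. In the hypothesis on \<open>C\<close> the observable is a bound variable, later
  instantiated with this average.\<close>

lemma window_replacement:
  fixes p :: "int \<Rightarrow> int" and \<delta> :: real and n :: nat
  defines "V \<equiv> \<lambda>\<eta>. block_mean (\<lambda>x. \<delta> - real (\<eta> (p x))) n"
  assumes \<delta>: "0 < \<delta>" "\<delta> < 1" and n: "1 \<le> n" and p: "\<And>x. x \<in> {1..int n} \<Longrightarrow> p x \<in> bulk N"
    and C: "\<And>V s. 0 \<le> s \<Longrightarrow> s \<le> T \<Longrightarrow> (\<And>\<eta>. \<eta> \<in> configs N \<Longrightarrow> \<bar>V \<eta>\<bar> \<le> 1) \<Longrightarrow>
      \<bar>block_mean (\<lambda>x. profile V \<delta> s (p x)) n\<bar> \<le> C"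
  shows "(\<integral>\<^sup>+\<omega>. ennreal \<bar>LBINT s:{0..T}. V (X s \<omega>)\<bar> \<partial>M) \<le> ennreal (sqrt (2 * T * C))"
proof -
  obtain K where gen: "bounded_generator (configs N) (accelerated_generator \<gamma> \<theta> \<kappa> \<alpha> \<beta> N) K"
    using bounded_accelerated_generator[OF \<alpha> \<beta>] .
  have V_alt: "V \<eta> = (\<Sum>x\<in>{1..int n}. \<delta> - real (\<eta> (p x))) / real n" for \<eta>
    by (simp add: V_def block_mean_def)
  have V1: "\<bar>V \<eta>\<bar> \<le> 1" if "\<eta> \<in> configs N" for \<eta>
  proof -
    have "\<bar>\<Sum>x\<in>{1..int n}. \<delta> - real (\<eta> (p x))\<bar> \<le> (\<Sum>x\<in>{1..int n}. 1)"
    proof (rule order_trans[OF sum_abs], rule sum_mono)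
      fix x assume "x \<in> {1..int n}"
      then show "\<bar>\<delta> - real (\<eta> (p x))\<bar> \<le> 1" using configs_value[OF that p] \<delta> by fastforce
    qed
    then show ?thesis using n by (simp add: V_alt)
  qed
  have corr: "integral {s..T} (\<lambda>t. \<integral>\<omega>. V (X s \<omega>) * V (X t \<omega>) \<partial>M) = block_mean (\<lambda>x. profile V \<delta> s (p x)) n"
    if s: "0 \<le> s" "s \<le> T" for s
  proof -
    have "(\<integral>\<omega>. V (X s \<omega>) * V (X t \<omega>) \<partial>M) = (\<Sum>x\<in>{1..int n}. covar V \<delta> s t (p x)) / real n"
      if t: "t \<in> {s..T}" for t
    proof -
      have "(\<integral>\<omega>. V (X s \<omega>) * V (X t \<omega>) \<partial>M)
        = (\<integral>\<omega>. (\<Sum>x\<in>{1..int n}. V (X s \<omega>) * (\<delta> - real (X t \<omega> (p x)))) / real n \<partial>M)"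
        by (rule Bochner_Integration.integral_cong[OF refl])
          (subst (2) V_alt, simp add: sum_distrib_left)
      also have "\<dots> = (\<Sum>x\<in>{1..int n}. covar V \<delta> s t (p x)) / real n"
        unfolding covar_def using covar_integrable[of s t V \<delta>] s t
        by (simp add: Bochner_Integration.integral_sum del: of_nat_Suc)
      finally show ?thesis .
    qed
    then have "integral {s..T} (\<lambda>t. \<integral>\<omega>. V (X s \<omega>) * V (X t \<omega>) \<partial>M)
      = integral {s..T} (\<lambda>t. (\<Sum>x\<in>{1..int n}. covar V \<delta> s t (p x)) / real n)"
      by (rule Henstock_Kurzweil_Integration.integral_cong)
    also have "\<dots> = (\<Sum>x\<in>{1..int n}. profile V \<delta> s (p x)) / real n"
      unfolding profile_def
      by (simp add: Henstock_Kurzweil_Integration.integral_sum integrable_continuous_real covar_continuous s)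
    finally show ?thesis by (simp add: block_mean_def)
  qed
  show ?thesis
    by (rule markov_second_moment[OF gen process V1 T]) (use corr C V1 in auto)
qed

lemma left_window:
  assumes "1 \<le> n" "n < N"
  shows "(\<integral>\<^sup>+\<omega>. ennreal \<bar>LBINT s:{0..T}. block_mean (\<lambda>x. \<alpha> - real (X s \<omega> x)) n\<bar> \<partial>M)
    \<le> ennreal (sqrt (2 * T * block_bound \<gamma> \<theta> \<kappa> T N (real n)))"
  by (rule window_replacement[OF \<alpha> assms(1)]) (use assms left_profile_mean in \<open>auto simp: bulk_def\<close>)

lemma right_window:
  assumes "1 \<le> n" "n < N"
  shows "(\<integral>\<^sup>+\<omega>. ennreal \<bar>LBINT s:{0..T}. block_mean (\<lambda>x. \<beta> - real (X s \<omega> (int N - x))) n\<bar> \<partial>M)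
    \<le> ennreal (sqrt (2 * T * block_bound \<gamma> \<theta> \<kappa> T N (real n)))"
  by (rule window_replacement[OF \<beta> assms(1)]) (use assms right_profile_mean in \<open>auto simp: bulk_def\<close>)

end

section \<open>The limits in N and \<epsilon>\<close>

lemma energy_const_nonneg: "1 < g \<Longrightarrow> g < 2 \<Longrightarrow> 0 < \<kappa> \<Longrightarrow> 0 < T \<Longrightarrow> 0 \<le> energy_const g \<kappa> T"
  unfolding energy_const_def using c_gamma_pos[of g] by (intro add_nonneg_nonneg) auto

text \<open>Used to replace the integer window length by the larger \<epsilon>N + 1, for which the
  limit in N is elementary.\<close>

lemma block_bound_mono:
  assumes "1 < g" "g < 2" "0 < \<kappa>" "0 < T" "0 \<le> l" "l \<le> l'"
  shows "block_bound g \<theta> \<kappa> T N l \<le> block_bound g \<theta> \<kappa> T N l'"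
  unfolding block_bound_def
  using assms energy_const_nonneg[OF assms(1-4)] chain_const_pos[OF assms(1)] c_gamma_pos[of g]
  by (intro add_mono order_refl mult_left_mono powr_mono2 divide_right_mono mult_nonneg_nonneg) auto

lemma block_bound_limit:
  assumes "1 < g" "0 < \<epsilon>" "\<theta> < g - 1"
  shows "(\<lambda>N. block_bound g \<theta> \<kappa> T N (\<epsilon> * real N + 1)) \<longlonglongrightarrow>
    chain_const g * sqrt (6 * energy_const g \<kappa> T / c_gamma g) * \<epsilon> powr ((g - 1) / 2) + T * \<epsilon>"
proof -
  have "(\<lambda>N. \<epsilon> + 1 / real N) \<longlonglongrightarrow> \<epsilon> + 0"
    by (intro tendsto_intros lim_1_over_n)
  then have "(\<lambda>N. \<epsilon> + 1 / real N) \<longlonglongrightarrow> \<epsilon>" by simp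
  then have e: "(\<lambda>N. (\<epsilon> * real N + 1) / real N) \<longlonglongrightarrow> \<epsilon>"
    by (rule Lim_transform_eventually)
      (use eventually_gt_at_top[of 0] in \<open>eventually_elim, simp add: field_simps\<close>)
  \<comment> \<open>The exponent is negative exactly because \<theta> < g - 1: the killing at the
    boundary site beats the energy.\<close>
  have p: "(\<lambda>N. real N powr (\<theta> + 1 - g)) \<longlonglongrightarrow> 0"
    by (rule tendsto_neg_powr[OF _ filterlim_real_sequentially]) (use assms in simp)
  have "(\<lambda>N. block_bound g \<theta> \<kappa> T N (\<epsilon> * real N + 1)) \<longlonglongrightarrow>
    sqrt (energy_const g \<kappa> T * 0 / (2 * \<kappa> * c_gamma g))
    + chain_const g * sqrt (6 * energy_const g \<kappa> T / c_gamma g) * \<epsilon> powr ((g - 1) / 2) + T * \<epsilon>"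
    unfolding block_bound_def divide_inverse[of _ "2 * \<kappa> * c_gamma g"]
    by (intro tendsto_add tendsto_mult tendsto_real_sqrt tendsto_const e tendsto_powr p) (use assms in auto)
  then show ?thesis by simp
qed

text \<open>Stated for a generic \<open>f\<close> so that it applies at both boundaries. The bound
  is asked only for windows inside the bulk, which is eventually the case for each \<epsilon> <
  1.\<close>

lemma window_limit:
  fixes f :: "real \<Rightarrow> nat \<Rightarrow> ennreal"
  assumes g: "1 < g" "g < 2" "\<theta> < g - 1" and \<kappa>: "0 < \<kappa>" and T: "0 < T"
    and f: "\<And>\<epsilon> N n. 2 \<le> N \<Longrightarrow> int n = \<lceil>\<epsilon> * real N\<rceil> \<Longrightarrow> 1 \<le> n \<Longrightarrow> n < N \<Longrightarrow>
      f \<epsilon> N \<le> ennreal (sqrt (2 * T * block_bound g \<theta> \<kappa> T N (real n)))"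
  shows "Limsup (at_right 0) (\<lambda>\<epsilon>. Limsup sequentially (f \<epsilon>)) = 0"
proof -
  define h where "h \<epsilon> = chain_const g * sqrt (6 * energy_const g \<kappa> T / c_gamma g) * \<epsilon> powr ((g - 1) / 2) + T * \<epsilon>" for \<epsilon>
  have "Limsup sequentially (f \<epsilon>) \<le> ennreal (sqrt (2 * T * h \<epsilon>))" if \<epsilon>: "0 < \<epsilon>" "\<epsilon> < 1" for \<epsilon>
  proof -
    let ?u = "\<lambda>N. ennreal (sqrt (2 * T * block_bound g \<theta> \<kappa> T N (\<epsilon> * real N + 1)))"
    \<comment> \<open>\<open>1 / (1 - \<epsilon>) \<le> real N\<close> says \<epsilon>N + 1 \<le> N;
      as the ceiling of \<epsilon>N is below \<epsilon>N + 1, the window fits into the bulk.\<close>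
    have "\<forall>\<^sub>F N in sequentially. 1 / (1 - \<epsilon>) \<le> real N"
      using eventually_ge_at_top by (rule eventually_compose_filterlim[OF _ filterlim_real_sequentially])
    then have "\<forall>\<^sub>F N in sequentially. f \<epsilon> N \<le> ?u N"
      using eventually_ge_at_top[of 2]
    proof eventually_elim
      case (elim N)
      define n where "n = nat \<lceil>\<epsilon> * real N\<rceil>"
      have pos: "0 < \<epsilon> * real N" using \<epsilon> elim by simp
      then have n: "int n = \<lceil>\<epsilon> * real N\<rceil>" by (simp add: n_def)
      have "1 \<le> int n" unfolding n using pos by linarith
      moreover have nb: "real n < \<epsilon> * real N + 1"
        using ceiling_correct[of "\<epsilon> * real N"] n by linarith
      moreover have "\<epsilon> * real N + 1 \<le> real N"
        using elim(1) \<epsilon> by (simp add: pos_divide_le_eq algebra_simps)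
      ultimately have "f \<epsilon> N \<le> ennreal (sqrt (2 * T * block_bound g \<theta> \<kappa> T N (real n)))"
        by (intro f[OF elim(2) n]) linarith+
      also have "\<dots> \<le> ?u N"
        using block_bound_mono[OF g(1,2) \<kappa> T, of "real n" "\<epsilon> * real N + 1"] nb T
        by (intro ennreal_leI real_sqrt_le_mono mult_left_mono) auto
      finally show ?case .
    qed
    then have "Limsup sequentially (f \<epsilon>) \<le> Limsup sequentially ?u" by (rule Limsup_mono)
    also have "?u \<longlonglongrightarrow> ennreal (sqrt (2 * T * h \<epsilon>))"
      unfolding h_def
      by (intro tendsto_ennrealI tendsto_real_sqrt tendsto_mult tendsto_const block_bound_limit g \<epsilon>)
    then have "Limsup sequentially ?u = ennreal (sqrt (2 * T * h \<epsilon>))"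
      by (rule lim_imp_Limsup[OF sequentially_bot])
    finally show ?thesis .
  qed
  then have "\<forall>\<^sub>F \<epsilon> in at_right 0. Limsup sequentially (f \<epsilon>) \<le> ennreal (sqrt (2 * T * h \<epsilon>))"
    unfolding eventually_at_right_field by (intro exI[of _ 1]) simp
  then have "Limsup (at_right 0) (\<lambda>\<epsilon>. Limsup sequentially (f \<epsilon>))
      \<le> Limsup (at_right 0) (\<lambda>\<epsilon>. ennreal (sqrt (2 * T * h \<epsilon>)))"
    by (rule Limsup_mono)
  also have "(h \<longlongrightarrow> chain_const g * sqrt (6 * energy_const g \<kappa> T / c_gamma g) * 0 + T * 0) (at_right 0)"
  proof -
    have "((\<lambda>\<epsilon>::real. \<epsilon> powr ((g - 1) / 2)) \<longlongrightarrow> 0) (at_right 0)"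
      using g by (intro tendsto_zero_powrI[OF tendsto_ident_at tendsto_const])
        (auto simp: eventually_at_right_field intro: exI[of _ 1])
    then show ?thesis unfolding h_def by (intro tendsto_intros)
  qed
  then have "((\<lambda>\<epsilon>. ennreal (sqrt (2 * T * h \<epsilon>))) \<longlongrightarrow> ennreal (sqrt (2 * T * 0))) (at_right 0)"
    by (intro tendsto_ennrealI tendsto_real_sqrt tendsto_mult tendsto_const) simp
  then have "Limsup (at_right 0) (\<lambda>\<epsilon>. ennreal (sqrt (2 * T * h \<epsilon>))) = 0"
    using lim_imp_Limsup[OF trivial_limit_at_right_real] by fastforce
  finally show ?thesis by simp
qed

lemma right_average_block_mean:
  assumes "int n = \<lceil>l\<rceil>" "1 \<le> n"
  shows "\<delta> - right_average l \<eta> 0 = block_mean (\<lambda>x. \<delta> - real (\<eta> x)) n"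
  using assms(2) by (simp add: right_average_def block_mean_def assms(1)[symmetric] sum_subtractf diff_divide_distrib)

lemma left_average_block_mean:
  assumes "int n = \<lceil>l\<rceil>" "1 \<le> n"
  shows "\<delta> - left_average l \<eta> (int N) = block_mean (\<lambda>x. \<delta> - real (\<eta> (int N - x))) n"
proof -
  have "(\<Sum>y\<in>{int N - int n..int N - 1}. real (\<eta> y)) = (\<Sum>x\<in>{1..int n}. real (\<eta> (int N - x)))"
    by (rule sum.reindex_bij_witness[of _ "\<lambda>x. int N - x" "\<lambda>x. int N - x"]) auto
  then show ?thesis
    using assms(2) by (simp add: left_average_def block_mean_def assms(1)[symmetric] sum_subtractf diff_divide_distrib)
qed

theorem proposition5p3:
  fixes \<gamma> \<theta> \<kappa> \<alpha> \<beta> T :: real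
    and \<mu> :: "nat \<Rightarrow> config measure"
    and M :: "nat \<Rightarrow> 'w measure"
    and \<eta> :: "nat \<Rightarrow> real \<Rightarrow> 'w \<Rightarrow> config"
  assumes "1 < \<gamma>" and "\<gamma> < 2" and "0 \<le> \<theta>" and "\<theta> < \<gamma> - 1" and "0 < \<kappa>"
    and "0 < \<alpha>" and "\<alpha> < 1" and "0 < \<beta>" and "\<beta> < 1"
    and "\<And>N. 2 \<le> N \<Longrightarrow> prob_space (\<mu> N)"
    and "\<And>N. 2 \<le> N \<Longrightarrow> sets (\<mu> N) = Pow (configs N)"
    and "\<And>N. 2 \<le> N \<Longrightarrow>
           markov_process (M N) (configs N) (accelerated_generator \<gamma> \<theta> \<kappa> \<alpha> \<beta> N) (\<mu> N) (\<eta> N)"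
    and "0 < T"
  shows "(Limsup (at_right 0) (\<lambda>\<epsilon>::real. Limsup sequentially (\<lambda>N.
           \<integral>\<^sup>+\<omega>. ennreal \<bar>LBINT s:{0..T}. \<alpha> - right_average (\<epsilon> * real N) (\<eta> N s \<omega>) 0\<bar> \<partial>M N)) = 0) \<and>
         (Limsup (at_right 0) (\<lambda>\<epsilon>::real. Limsup sequentially (\<lambda>N.
           \<integral>\<^sup>+\<omega>. ennreal \<bar>LBINT s:{0..T}. \<beta> - left_average (\<epsilon> * real N) (\<eta> N s \<omega>) (int N)\<bar> \<partial>M N)) = 0)"
proof
  have process: "exclusion_process \<gamma> \<theta> \<kappa> \<alpha> \<beta> T N (M N) (\<mu> N) (\<eta> N)" if "2 \<le> N" for N
    by unfold_locales (use assms that in auto)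
  show "Limsup (at_right 0) (\<lambda>\<epsilon>::real. Limsup sequentially (\<lambda>N.
      \<integral>\<^sup>+\<omega>. ennreal \<bar>LBINT s:{0..T}. \<alpha> - right_average (\<epsilon> * real N) (\<eta> N s \<omega>) 0\<bar> \<partial>M N)) = 0"
  proof (rule window_limit[OF assms(1,2,4,5,13)])
    fix \<epsilon> :: real and N n
    assume "2 \<le> N" and n: "int n = \<lceil>\<epsilon> * real N\<rceil>" "1 \<le> n" "n < N"
    from exclusion_process.left_window[OF process[OF this(1)] n(2,3)]
    show "(\<integral>\<^sup>+\<omega>. ennreal \<bar>LBINT s:{0..T}. \<alpha> - right_average (\<epsilon> * real N) (\<eta> N s \<omega>) 0\<bar> \<partial>M N)
      \<le> ennreal (sqrt (2 * T * block_bound \<gamma> \<theta> \<kappa> T N (real n)))"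
      by (simp only: right_average_block_mean[OF n(1,2)])
  qed
  show "Limsup (at_right 0) (\<lambda>\<epsilon>::real. Limsup sequentially (\<lambda>N.
      \<integral>\<^sup>+\<omega>. ennreal \<bar>LBINT s:{0..T}. \<beta> - left_average (\<epsilon> * real N) (\<eta> N s \<omega>) (int N)\<bar> \<partial>M N)) = 0"
  proof (rule window_limit[OF assms(1,2,4,5,13)])
    fix \<epsilon> :: real and N n
    assume "2 \<le> N" and n: "int n = \<lceil>\<epsilon> * real N\<rceil>" "1 \<le> n" "n < N"
    from exclusion_process.right_window[OF process[OF this(1)] n(2,3)]
    show "(\<integral>\<^sup>+\<omega>. ennreal \<bar>LBINT s:{0..T}. \<beta> - left_average (\<epsilon> * real N) (\<eta> N s \<omega>) (int N)\<bar> \<partial>M N)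
      \<le> ennreal (sqrt (2 * T * block_bound \<gamma> \<theta> \<kappa> T N (real n)))"
      by (simp only: left_average_block_mean[OF n(1,2)])
  qed
qed

end
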